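(* Let $f:\mathbb{R}^{d_x}\times\mathbb{R}^{d_y}\to\mathbb{R}$ be twice continuously differentiable with $\rho$-Lipschitz continuous Hessians, convex in $x$ and concave in $y$, and having at least one saddle point. Let $z^*=(x^*,y^* )$ be a saddle point, $\beta=\|z_0-z^*\|$, and $M=3\rho m$. Count the computational complexity of computing $F(\cdot)$ as $N$ and that of computing $\nabla F(\cdot)$ as $Nd$. Then the Schur-decomposition implementation of LEN with $m=\Theta(d)$ finds an $\epsilon$-saddle point with computational complexity $$\tilde{\mathcal{O}}\big((N+d^2)(d+d^{2/3}\epsilon^{-2/3})\big).$$
   Context: Notation: $d=d_x+d_y$, $z=(x,y)\in\mathbb{R}^d$, $\|\cdot\|$ is the Euclidean norm (spectral norm for matrices), $\mathbb{B}_r(w)$ is the ball of radius $r$ centered at $w$, $m$ is a positive integer; $\tilde{\mathcal O}$ hides logarithmic factors. $f$ has $\rho$-Lipschitz continuous Hessians if $\|\nabla^2 f(x,y)-\nabla^2 f(x',y')\|\le\rho\|(x,y)-(x',y')\|$ for all points. A saddle point is $(x^*,y^* )$ with $f(x^*,y)\le f(x^*,y^* )\le f(x,y^* )$ for all $x,y$. Let $F(z)=\begin{bmatrix}\nabla_x f(x,y)\\ -\nabla_y f(x,y)\end{bmatrix}$ and let $\nabla F(z)$ be its Jacobian. Restricted gap: for $r$ sufficiently large that $\max\{\|\hat x-x^*\|,\|\hat y-y^*\|\}\le r$, $\mathrm{Gap}(\hat x,\hat y;r)=\max_{y\in\mathbb{B}_r(y^* )}f(\hat x,y)-\min_{x\in\mathbb{B}_r(x^*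 )}f(x,\hat y)$. The point $(\hat x,\hat y)$ is an $\epsilon$-saddle point if $\mathrm{Gap}(\hat x,\hat y;r)\le\epsilon$ with $r=\Omega(\max\{\|x_0-x^*\|,\|y_0-y^*\|\})$, where $z_0=(x_0,y_0)$. Implementation of LEN$(z_0,T,m,M)$: let $\pi(t)=t-(t\bmod m)$. For $t=0,\dots,T-1$: (i) if $t\bmod m=0$, compute the Schur decomposition $\nabla F(z_t)=QUQ^{-1}$ with $Q\in\mathbb{C}^{d\times d}$ unitary and $U\in\mathbb{C}^{d\times d}$ upper triangular; (ii) compute $\gamma_t$ as the root of $\phi(\gamma)=M\|(\nabla F(z_{\pi(t)})+\gamma I_d)^{-1}F(z_t)\|-\gamma$ by a binary search (linear systems with matrix $\nabla F(z_{\pi(t)})+\gamma I_d$ are solved through $Q(U+\gamma I_d)^{-1}Q^{-1}$); (iii) compute the lazy cubic step $z_{t+1/2}=z_t-Q(U+\gamma_t I_d)^{-1}Q^{-1}F(z_t)$; (iv) compute the extra-gradient step $z_{t+1}=z_t-\gamma_t^{-1}F(z_{t+1/2})$. Return $\bar z_T=\big(\sum_{t=0}^{T-1}\gamma_t^{-1}\big)^{-1}\sum_{t=0}^{T-1}\gamma_t^{-1}z_{t+1/2}$. The computational complexity is the cost of the oracle calls to $F$ and $\nabla F$ plus the cost of the updates, with classical linear algebra: a Schur decomposition costs $\mathcal{O}(d^3)$ and an upper-triangular solve by back substitution costs $\mathcal{O}(d^2)$. *)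

theory Defs
  imports
    "HOL-Analysis.Analysis"
    "HOL-Library.Landau_Symbols"
    "Jordan_Normal_Form.Schur_Decomposition"
begin

(* The dimensions must range inside one formula, because the constants hidden in the
   complexity bound may not depend on them. Points of R^n are therefore elements of
   "carrier_vec n" rather than of a Euclidean type, and the calculus below is spelled out
   for this representation. *)

definition vnorm :: "real vec \<Rightarrow> real" where
  "vnorm v = sqrt (v \<bullet> v)"

definition specnorm :: "real mat \<Rightarrow> real" where
  "specnorm A = (SUP v\<in>{v \<in> carrier_vec (dim_col A). vnorm v \<le> 1}. vnorm (A *\<^sub>v v))"

definition vball :: "real vec \<Rightarrow> real \<Rightarrow> real vec set" where
  "vball c r = {v \<in> carrier_vec (dim_vec c). vnorm (v - c) \<le> r}"

(* Frechet differentiability at p; the ambient dimension is that of p. *)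

definition has_gradient :: "(real vec \<Rightarrow> real) \<Rightarrow> real vec \<Rightarrow> real vec \<Rightarrow> bool" where
  "has_gradient h g p \<longleftrightarrow> g \<in> carrier_vec (dim_vec p) \<and>
     (\<forall>e>0. \<exists>\<delta>>0. \<forall>u\<in>carrier_vec (dim_vec p). vnorm u < \<delta> \<longrightarrow>
        \<bar>h (p + u) - h p - g \<bullet> u\<bar> \<le> e * vnorm u)"

definition gradient :: "(real vec \<Rightarrow> real) \<Rightarrow> real vec \<Rightarrow> real vec" where
  "gradient h p = (THE g. has_gradient h g p)"

definition has_jacobian :: "(real vec \<Rightarrow> real vec) \<Rightarrow> real mat \<Rightarrow> real vec \<Rightarrow> bool" where
  "has_jacobian G A p \<longleftrightarrow> A \<in> carrier_mat (dim_vec (G p)) (dim_vec p) \<and>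
     (\<forall>e>0. \<exists>\<delta>>0. \<forall>u\<in>carrier_vec (dim_vec p). vnorm u < \<delta> \<longrightarrow>
        vnorm (G (p + u) - G p - A *\<^sub>v u) \<le> e * vnorm u)"

definition jacobian :: "(real vec \<Rightarrow> real vec) \<Rightarrow> real vec \<Rightarrow> real mat" where
  "jacobian G p = (THE A. has_jacobian G A p)"

definition hessian :: "(real vec \<Rightarrow> real) \<Rightarrow> real vec \<Rightarrow> real mat" where
  "hessian h = jacobian (gradient h)"

definition twice_cont_diff :: "nat \<Rightarrow> (real vec \<Rightarrow> real) \<Rightarrow> bool" where
  "twice_cont_diff n h \<longleftrightarrow>
     (\<forall>p\<in>carrier_vec n. \<exists>g. has_gradient h g p) \<and>
     (\<forall>p\<in>carrier_vec n. \<exists>A. has_jacobian (gradient h) A p) \<and>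
     (\<forall>p\<in>carrier_vec n. \<forall>e>0. \<exists>\<delta>>0. \<forall>q\<in>carrier_vec n.
        vnorm (q - p) < \<delta> \<longrightarrow> specnorm (hessian h q - hessian h p) < e)"

definition lipschitz_hessian :: "nat \<Rightarrow> real \<Rightarrow> (real vec \<Rightarrow> real) \<Rightarrow> bool" where
  "lipschitz_hessian n \<rho> h \<longleftrightarrow>
     (\<forall>p\<in>carrier_vec n. \<forall>q\<in>carrier_vec n.
        specnorm (hessian h p - hessian h q) \<le> \<rho> * vnorm (p - q))"

definition convex_fun :: "nat \<Rightarrow> (real vec \<Rightarrow> real) \<Rightarrow> bool" where
  "convex_fun n h \<longleftrightarrow>
     (\<forall>p\<in>carrier_vec n. \<forall>q\<in>carrier_vec n. \<forall>s. 0 \<le> s \<and> s \<le> 1 \<longrightarrow>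
        h (s \<cdot>\<^sub>v p + (1 - s) \<cdot>\<^sub>v q) \<le> s * h p + (1 - s) * h q)"

definition concave_fun :: "nat \<Rightarrow> (real vec \<Rightarrow> real) \<Rightarrow> bool" where
  "concave_fun n h \<longleftrightarrow> convex_fun n (\<lambda>p. - h p)"

definition joint :: "nat \<Rightarrow> nat \<Rightarrow> (real vec \<Rightarrow> real vec \<Rightarrow> real) \<Rightarrow> real vec \<Rightarrow> real" where
  "joint dx dy f z = f (vec_first z dx) (vec_last z dy)"

definition is_saddle ::
  "nat \<Rightarrow> nat \<Rightarrow> (real vec \<Rightarrow> real vec \<Rightarrow> real) \<Rightarrow> real vec \<Rightarrow> real vec \<Rightarrow> bool" where
  "is_saddle dx dy f xs ys \<longleftrightarrow> xs \<in> carrier_vec dx \<and> ys \<in> carrier_vec dy \<and>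
     (\<forall>x\<in>carrier_vec dx. \<forall>y\<in>carrier_vec dy. f xs y \<le> f xs ys \<and> f xs ys \<le> f x ys)"

definition saddle_field ::
  "nat \<Rightarrow> nat \<Rightarrow> (real vec \<Rightarrow> real vec \<Rightarrow> real) \<Rightarrow> real vec \<Rightarrow> real vec" where
  "saddle_field dx dy f z =
     (let x = vec_first z dx; y = vec_last z dy
      in gradient (\<lambda>u. f u y) x @\<^sub>v - gradient (\<lambda>v. f x v) y)"

(* For continuous f the supremum and the infimum are attained, as the balls are compact. *)

definition gap ::
  "(real vec \<Rightarrow> real vec \<Rightarrow> real) \<Rightarrow> real vec \<Rightarrow> real vec \<Rightarrow> real vec \<Rightarrow> real vec \<Rightarrow> real \<Rightarrow> real" where
  "gap f xs ys xh yh r = (SUP y\<in>vball ys r. f xh y) - (INF x\<in>vball xs r. f x yh)"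

(* kappa is the constant hidden in r = Omega(max (norm (x0 - xs)) (norm (y0 - ys))); the second
   bound on r is the proviso under which the restricted gap is defined. *)

definition eps_saddle ::
  "real \<Rightarrow> nat \<Rightarrow> nat \<Rightarrow> (real vec \<Rightarrow> real vec \<Rightarrow> real) \<Rightarrow> real vec \<Rightarrow> real vec \<Rightarrow>
   real vec \<Rightarrow> real vec \<Rightarrow> real \<Rightarrow> real vec \<Rightarrow> bool" where
  "eps_saddle \<kappa> dx dy f xs ys x0 y0 \<epsilon> zh \<longleftrightarrow>
     (let xh = vec_first zh dx; yh = vec_last zh dy in
      zh \<in> carrier_vec (dx + dy) \<and>
      (\<exists>r. \<kappa> * max (vnorm (x0 - xs)) (vnorm (y0 - ys)) \<le> r \<and>
           max (vnorm (xh - xs)) (vnorm (yh - ys)) \<le> r \<and>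
           gap f xs ys xh yh r \<le> \<epsilon>))"

definition is_schur :: "nat \<Rightarrow> real mat \<Rightarrow> complex mat \<times> complex mat \<Rightarrow> bool" where
  "is_schur n A QU \<longleftrightarrow> (case QU of (Q, U) \<Rightarrow>
     Q \<in> carrier_mat n n \<and> U \<in> carrier_mat n n \<and> upper_triangular U \<and>
     Q * mat_adjoint Q = 1\<^sub>m n \<and> mat_adjoint Q * Q = 1\<^sub>m n \<and>
     map_mat complex_of_real A = Q * U * mat_adjoint Q)"

definition tri_solve :: "complex mat \<Rightarrow> complex vec \<Rightarrow> complex vec" where
  "tri_solve U b = (THE v. v \<in> carrier_vec (dim_row U) \<and> U *\<^sub>v v = b)"

(* Q (U + gamma I)^-1 Q^-1 b, where Q^-1 is the adjoint since Q is unitary. For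
   A = Q U Q^-1 real this is the real vector (A + gamma I)^-1 b, so Re discards nothing. *)

definition schur_solve :: "complex mat \<times> complex mat \<Rightarrow> real \<Rightarrow> real vec \<Rightarrow> real vec" where
  "schur_solve QU \<gamma> b = (case QU of (Q, U) \<Rightarrow>
     map_vec Re (Q *\<^sub>v tri_solve (U + complex_of_real \<gamma> \<cdot>\<^sub>m 1\<^sub>m (dim_row U))
                                (mat_adjoint Q *\<^sub>v map_vec complex_of_real b)))"

(* Prices of the primitive operations. "vecop" prices one operation on vectors of the ambient
   dimension (sum, scaling, norm) together with the scalar operations accompanying it. *)

record prices =
  eval_F :: real
  eval_DF :: real
  schur_dec :: real
  tri :: real
  matvec :: real
  vecop :: real

definition solve_price :: "prices \<Rightarrow> real" where
  "solve_price p = 2 * matvec p + tri p"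

(* Bisection for the root of a decreasing function on [lo, hi]. phi returns its value together
   with the price of evaluating it; the search returns the upper end of the final interval (hence a positive number) and
   the accumulated price. *)

primrec bisect :: "(real \<Rightarrow> real \<times> real) \<Rightarrow> nat \<Rightarrow> real \<Rightarrow> real \<Rightarrow> real \<times> real" where
  "bisect phi 0 lo hi = (hi, 0)"
| "bisect phi (Suc n) lo hi =
     (let mid = (lo + hi) / 2;
          (v, c) = phi mid;
          (\<gamma>, c') = (if v > 0 then bisect phi n mid hi else bisect phi n lo mid)
      in (\<gamma>, c + c'))"

(* Binary search on [0, Gamma]: ceiling (log 2 (Gamma / tol)) halvings bring the width
   of the interval down to at most tol. *)

definition binary_search :: "(real \<Rightarrow> real \<times> real) \<Rightarrow> real \<Rightarrow> real \<Rightarrow> real \<times> real" where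
  "binary_search phi \<Gamma> tol = bisect phi (nat \<lceil>log 2 (\<Gamma> / tol)\<rceil>) 0 \<Gamma>"

record len_state =
  iterate :: "real vec"
  factors :: "complex mat \<times> complex mat"
  weight_sum :: real
  weighted_sum :: "real vec"
  spent :: real

(* "factors" holds the Schur factors of DF at the last snapshot z_(pi t). *)

definition len_step ::
  "prices \<Rightarrow> (real mat \<Rightarrow> complex mat \<times> complex mat) \<Rightarrow> (real vec \<Rightarrow> real vec) \<Rightarrow>
   nat \<Rightarrow> real \<Rightarrow> real \<Rightarrow> real \<Rightarrow> nat \<Rightarrow> len_state \<Rightarrow> len_state" where
  "len_step p schur F m M \<Gamma> tol t s =
     (let z = iterate s;
          (QU, c1) = (if t mod m = 0 then (schur (jacobian F z), eval_DF p + schur_dec p)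
                      else (factors s, 0));
          g = F z;
          (\<gamma>, c2) = binary_search
             (\<lambda>\<gamma>. (M * vnorm (schur_solve QU \<gamma> g) - \<gamma>, solve_price p + vecop p)) \<Gamma> tol;
          zhalf = z - schur_solve QU \<gamma> g;
          znext = z - (1 / \<gamma>) \<cdot>\<^sub>v F zhalf
      in \<lparr> iterate = znext,
           factors = QU,
           weight_sum = weight_sum s + 1 / \<gamma>,
           weighted_sum = weighted_sum s + (1 / \<gamma>) \<cdot>\<^sub>v zhalf,
           spent = spent s + c1 + eval_F p + c2 + (solve_price p + vecop p)
                     + (eval_F p + 2 * vecop p) + 2 * vecop p \<rparr>)"

(* The initial factors are never used: step 0 is a snapshot. *)

primrec len_run ::
  "prices \<Rightarrow> (real mat \<Rightarrow> complex mat \<times> complex mat) \<Rightarrow> (real vec \<Rightarrow> real vec) \<Rightarrow>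
   nat \<Rightarrow> real \<Rightarrow> real \<Rightarrow> real \<Rightarrow> real vec \<Rightarrow> nat \<Rightarrow> len_state" where
  "len_run p schur F m M \<Gamma> tol z0 0 =
     \<lparr> iterate = z0, factors = (1\<^sub>m (dim_vec z0), 1\<^sub>m (dim_vec z0)), weight_sum = 0,
       weighted_sum = 0\<^sub>v (dim_vec z0), spent = 0 \<rparr>"
| "len_run p schur F m M \<Gamma> tol z0 (Suc t) =
     len_step p schur F m M \<Gamma> tol t (len_run p schur F m M \<Gamma> tol z0 t)"

(* LEN(z0, T, m, M): the averaged point and the total price of computing it. *)

definition len ::
  "prices \<Rightarrow> (real mat \<Rightarrow> complex mat \<times> complex mat) \<Rightarrow> (real vec \<Rightarrow> real vec) \<Rightarrow>
   real \<Rightarrow> real \<Rightarrow> real vec \<Rightarrow> nat \<Rightarrow> nat \<Rightarrow> real \<Rightarrow> real vec \<times> real" where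
  "len p schur F \<Gamma> tol z0 T m M =
     (let s = len_run p schur F m M \<Gamma> tol z0 T
      in ((1 / weight_sum s) \<cdot>\<^sub>v weighted_sum s, spent s + vecop p))"

end

theory Submission
  imports Defs
begin

text \<open>
  One step with weight \<open>\<gamma>\<close> and half step \<open>z' = z - v\<close> satisfies
  \<open>|z\<^sup>+ - w|\<^sup>2 = |z - w|\<^sup>2 - 2/\<gamma> F z' \<bullet> (z' - w) + |F z'/\<gamma> - v|\<^sup>2 - |v|\<^sup>2\<close>. The error term is a Taylor
  remainder with a stale Jacobian; since \<open>\<gamma> \<ge> 3 \<rho> m |v|\<close> it is at most
  \<open>(|v| + |z - z\<^sub>\<pi>|) / (3 m)\<close>, and over a period of length \<open>m\<close> the drift \<open>|z - z\<^sub>\<pi>|\<close> is controlled by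
  the steps themselves, so that the errors are absorbed by the terms \<open>- |v|\<^sup>2\<close>. Hence the iterates
  stay in the ball of radius \<open>\<beta>\<close>, \<open>\<Sum> |v|\<^sup>2 \<le> 7/3 \<beta>\<^sup>2\<close>, and the gap of the weighted average is at most
  \<open>O(1) / \<Sum> 1/\<gamma>\<close>. The binary search leaves \<open>\<gamma> \<le> 2 tol\<close>, which alone makes \<open>\<Sum> 1/\<gamma>\<close> large, or
  \<open>\<gamma> \<le> 12 \<rho> m |v|\<close>, and then \<open>\<Sum> 1/\<gamma> \<ge> T\<^bsup>3/2\<^esup> / O(m)\<close> by convexity. So \<open>T\<close> of order
  \<open>(m/\<epsilon>)\<^bsup>2/3\<^esup> + 1\<close> suffices, while a period costs \<open>O((N + d\<^sup>2) d)\<close> for the snapshot and each step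
  \<open>O(N + d\<^sup>2 log)\<close>.
\<close>

text \<open>Two obstacles shape the proof. The search returns a useful \<gamma> only if
  \<open>phi\<close> is nonpositive at the upper end \<Gamma>, which is known only while the
  iterates stay near the saddle point; they stay there only because the earlier searches succeeded.
  A strong induction settles both, with the search guarantee assumed conditionally. Moreover T,
  \<Gamma> and the tolerance are fixed before f, so no size bound on F is available: every estimate
  is drawn from \<rho>, \<beta>, m and the fact that F vanishes at the saddle point. The exact root
  of \<open>phi\<close> is never reached. Returning the upper end of the bracket keeps the
  inequality \<gamma> >= M |v|, on which the descent rests, free of any loss; only the converse
  loses a factor 4. The order m = \<Theta>(d) enters in both directions: m <= O(d) bounds the number
  of steps, and d <= O(m) spreads the price of the snapshots so that each step carries O(N + d^2) of
  it.\<close>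

unbundle no inner_syntax and no vec_syntax

section \<open>Vectors, gradients and Jacobians\<close>

lemma vnorm_ge_0 [simp]: "0 \<le> vnorm v"
  by (simp add: vnorm_def scalar_prod_def sum_nonneg)

lemma vnorm_power2: "(vnorm v)\<^sup>2 = v \<bullet> v"
  by (simp add: vnorm_def scalar_prod_def sum_nonneg)

lemma vnorm_eq_L2_set: "vnorm v = L2_set (\<lambda>i. v $ i) {0..<dim_vec v}"
  by (simp add: vnorm_def L2_set_def scalar_prod_def power2_eq_square)

lemma vnorm_zero [simp]: "vnorm (0\<^sub>v n) = 0"
  by (simp add: vnorm_def)

lemma vnorm_eq_0: "v \<in> carrier_vec n \<Longrightarrow> vnorm v = 0 \<longleftrightarrow> v = 0\<^sub>v n"
  unfolding vnorm_eq_L2_set by (subst L2_set_eq_0_iff) auto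

lemma abs_scalar_prod_le:
  assumes "u \<in> carrier_vec n" "v \<in> carrier_vec n"
  shows "\<bar>u \<bullet> v\<bar> \<le> vnorm u * vnorm v"
proof -
  have "\<bar>u \<bullet> v\<bar> \<le> (\<Sum>i\<in>{0..<n}. \<bar>u $ i\<bar> * \<bar>v $ i\<bar>)"
    using assms by (auto simp: scalar_prod_def abs_mult intro!: order.trans[OF sum_abs])
  also have "\<dots> \<le> vnorm u * vnorm v"
    using assms by (simp add: vnorm_eq_L2_set L2_set_mult_ineq)
  finally show ?thesis .
qed

lemma scalar_prod_le:
  assumes "u \<in> carrier_vec n" "v \<in> carrier_vec n"
  shows "u \<bullet> v \<le> vnorm u * vnorm v"
  using abs_scalar_prod_le[OF assms] by linarith

lemma vnorm_add_le:
  assumes "u \<in> carrier_vec n" "v \<in> carrier_vec n"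
  shows "vnorm (u + v) \<le> vnorm u + vnorm v"
proof -
  have "vnorm (u + v) = L2_set (\<lambda>i. u $ i + v $ i) {0..<n}"
    using assms unfolding vnorm_eq_L2_set by (intro L2_set_cong) auto
  then show ?thesis
    using assms L2_set_triangle_ineq[of "\<lambda>i. u $ i" "\<lambda>i. v $ i" "{0..<n}"]
    by (simp add: vnorm_eq_L2_set)
qed

lemma vnorm_smult: "vnorm (c \<cdot>\<^sub>v v) = \<bar>c\<bar> * vnorm v"
proof -
  have "(c \<cdot>\<^sub>v v) \<bullet> (c \<cdot>\<^sub>v v) = c\<^sup>2 * (v \<bullet> v)"
    by (simp add: power2_eq_square)
  then show ?thesis
    by (simp add: vnorm_def real_sqrt_mult)
qed

lemma vnorm_uminus [simp]: "vnorm (- v) = vnorm v"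
  by (simp add: vnorm_def)

lemma vnorm_minus_commute:
  assumes "u \<in> carrier_vec n" "v \<in> carrier_vec n"
  shows "vnorm (u - v) = vnorm (v - u)"
proof -
  have "u - v = - (v - u)" using assms by (intro eq_vecI) auto
  then show ?thesis by (metis vnorm_uminus)
qed

lemma vnorm_diff_le:
  assumes "u \<in> carrier_vec n" "v \<in> carrier_vec n"
  shows "vnorm (u - v) \<le> vnorm u + vnorm v"
proof -
  have "u - v = u + - v" using assms by auto
  then show ?thesis using vnorm_add_le[of u n "- v"] assms by simp
qed

lemma vnorm_diff_triangle:
  assumes "u \<in> carrier_vec n" "v \<in> carrier_vec n" "w \<in> carrier_vec n"
  shows "vnorm (u - w) \<le> vnorm (u - v) + vnorm (v - w)"
proof -
  have "u - w = (u - v) + (v - w)" using assms by (intro eq_vecI) auto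
  then show ?thesis using vnorm_add_le[of "u - v" n "v - w"] assms by simp
qed

lemma vnorm_append:
  assumes "u \<in> carrier_vec k" "v \<in> carrier_vec n"
  shows "(vnorm (u @\<^sub>v v))\<^sup>2 = (vnorm u)\<^sup>2 + (vnorm v)\<^sup>2"
  unfolding vnorm_power2 by (rule scalar_prod_append[OF assms assms])

lemma vnorm_append_ge:
  assumes "u \<in> carrier_vec k" "v \<in> carrier_vec n"
  shows "vnorm u \<le> vnorm (u @\<^sub>v v)" "vnorm v \<le> vnorm (u @\<^sub>v v)"
  by (rule power2_le_imp_le; simp add: vnorm_append[OF assms])+

lemma vnorm_append_le:
  assumes "u \<in> carrier_vec k" "v \<in> carrier_vec n"
  shows "vnorm (u @\<^sub>v v) \<le> vnorm u + vnorm v"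
  by (rule power2_le_imp_le) (simp_all add: vnorm_append[OF assms] power2_sum)

lemma append_vec_minus:
  fixes a b c e :: "real vec"
  assumes "a \<in> carrier_vec k" "b \<in> carrier_vec k" "c \<in> carrier_vec n" "e \<in> carrier_vec n"
  shows "(a @\<^sub>v c) - (b @\<^sub>v e) = (a - b) @\<^sub>v (c - e)"
  using assms by (intro eq_vecI) auto

lemma vec_first_append:
  "u \<in> carrier_vec k \<Longrightarrow> v \<in> carrier_vec n \<Longrightarrow> vec_first (u @\<^sub>v v) k = u"
  by (intro eq_vecI) (auto simp: vec_first_def)

lemma vec_last_append:
  "u \<in> carrier_vec k \<Longrightarrow> v \<in> carrier_vec n \<Longrightarrow> vec_last (u @\<^sub>v v) n = v"
  by (intro eq_vecI) (auto simp: vec_last_def)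

lemma vnorm_mult_mat_vec_bounded:
  fixes A :: "real mat"
  shows "\<exists>B. \<forall>v\<in>carrier_vec (dim_col A). vnorm (A *\<^sub>v v) \<le> B * vnorm v"
proof (intro exI ballI)
  fix v :: "real vec" assume v: "v \<in> carrier_vec (dim_col A)"
  have "vnorm (A *\<^sub>v v) \<le> (\<Sum>i\<in>{0..<dim_row A}. \<bar>(A *\<^sub>v v) $ i\<bar>)"
    unfolding vnorm_eq_L2_set dim_mult_mat_vec by (rule L2_set_le_sum_abs)
  also have "\<dots> \<le> (\<Sum>i\<in>{0..<dim_row A}. vnorm (row A i) * vnorm v)"
    using v by (intro sum_mono) (auto intro!: abs_scalar_prod_le)
  finally show "vnorm (A *\<^sub>v v) \<le> (\<Sum>i\<in>{0..<dim_row A}. vnorm (row A i)) * vnorm v"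
    by (simp add: sum_distrib_right)
qed

text \<open>The supremum in \<open>specnorm\<close> is taken in the conditionally complete reals, so
  it dominates its members only once the set is known to be bounded. The crude bound by row norms
  supplies that, and scaling carries the estimate from the unit ball to every v.\<close>

lemma vnorm_mult_mat_vec_le:
  assumes A: "A \<in> carrier_mat k n" and v: "v \<in> carrier_vec n"
  shows "vnorm (A *\<^sub>v v) \<le> specnorm A * vnorm v"
proof (cases "vnorm v = 0")
  case True
  then have "v = 0\<^sub>v n" using vnorm_eq_0[OF v] by simp
  then have "A *\<^sub>v v = 0\<^sub>v k" using A by (auto intro!: eq_vecI)
  then show ?thesis using True by simp
next
  case False
  then have pos: "vnorm v > 0" using vnorm_ge_0[of v] by linarith
  obtain B where B: "\<And>u. u \<in> carrier_vec n \<Longrightarrow> vnorm (A *\<^sub>v u) \<le> B * vnorm u"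
    using vnorm_mult_mat_vec_bounded[of A] A by auto
  define u where "u = (1 / vnorm v) \<cdot>\<^sub>v v"
  have u: "u \<in> carrier_vec n" "vnorm u \<le> 1" using v pos by (auto simp: u_def vnorm_smult)
  have bdd: "bdd_above ((\<lambda>v. vnorm (A *\<^sub>v v)) ` {v \<in> carrier_vec (dim_col A). vnorm v \<le> 1})"
  proof (rule bdd_aboveI)
    fix x assume "x \<in> (\<lambda>v. vnorm (A *\<^sub>v v)) ` {v \<in> carrier_vec (dim_col A). vnorm v \<le> 1}"
    then obtain w where w: "w \<in> carrier_vec n" "vnorm w \<le> 1" "x = vnorm (A *\<^sub>v w)" using A by auto
    have "x \<le> B * vnorm w" using B w by auto
    also have "\<dots> \<le> \<bar>B\<bar> * 1" using w(2) by (intro mult_mono) auto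
    finally show "x \<le> \<bar>B\<bar>" by simp
  qed
  have "vnorm (A *\<^sub>v u) \<le> specnorm A"
    unfolding specnorm_def by (rule cSUP_upper) (use u A bdd in auto)
  moreover have "vnorm (A *\<^sub>v u) = vnorm (A *\<^sub>v v) / vnorm v"
    unfolding u_def using mult_mat_vec[OF A v] pos by (simp add: vnorm_smult)
  ultimately show ?thesis using pos by (simp add: field_simps)
qed

text \<open>\<open>gradient\<close> is a definite description and gets its value only through
  uniqueness. Two candidates are compared along their own difference w, where they disagree to first
  order.\<close>

lemma has_gradient_unique:
  assumes "has_gradient h g p" "has_gradient h g' p"
  shows "g = g'"
proof -
  define n where "n = dim_vec p"
  have c: "g \<in> carrier_vec n" "g' \<in> carrier_vec n"
    using assms by (auto simp: has_gradient_def n_def)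
  define w where "w = g - g'"
  have w: "w \<in> carrier_vec n" using c by (auto simp: w_def)
  have "vnorm w = 0"
  proof (rule ccontr)
    assume "vnorm w \<noteq> 0"
    then have pos: "vnorm w > 0" using vnorm_ge_0[of w] by linarith
    \<comment> \<open>Each candidate errs by at most e |u|; with this e both errors together reach
      only half of t |w|^2, the actual disagreement at u = t w.\<close>
    define e where "e = vnorm w / 4"
    have e: "e > 0" using pos by (simp add: e_def)
    obtain \<delta>1 where d1: "\<delta>1 > 0" "\<And>u. u \<in> carrier_vec n \<Longrightarrow> vnorm u < \<delta>1 \<Longrightarrow>
        \<bar>h (p + u) - h p - g \<bullet> u\<bar> \<le> e * vnorm u"
      using assms(1) e unfolding has_gradient_def n_def by blast
    obtain \<delta>2 where d2: "\<delta>2 > 0" "\<And>u. u \<in> carrier_vec n \<Longrightarrow> vnorm u < \<delta>2 \<Longrightarrow>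
        \<bar>h (p + u) - h p - g' \<bullet> u\<bar> \<le> e * vnorm u"
      using assms(2) e unfolding has_gradient_def n_def by blast
    define t where "t = min \<delta>1 \<delta>2 / (2 * vnorm w)"
    have t: "t > 0" using d1 d2 pos by (simp add: t_def)
    define u where "u = t \<cdot>\<^sub>v w"
    have u: "u \<in> carrier_vec n" "vnorm u = t * vnorm w" using w t by (auto simp: u_def vnorm_smult)
    have "vnorm u = min \<delta>1 \<delta>2 / 2" using pos by (simp add: u t_def)
    then have "vnorm u < \<delta>1" "vnorm u < \<delta>2" using d1(1) d2(1) by auto
    then have "\<bar>g \<bullet> u - g' \<bullet> u\<bar> \<le> 2 * (e * vnorm u)" using d1(2) d2(2) u(1) by fastforce
    moreover have "g \<bullet> u - g' \<bullet> u = t * (vnorm w)\<^sup>2"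
      using minus_scalar_prod_distrib[OF c(1) c(2) u(1)] w
      by (simp add: w_def[symmetric] vnorm_power2) (simp add: u_def)
    ultimately have "t * (vnorm w)\<^sup>2 \<le> t * (vnorm w)\<^sup>2 / 2"
      by (simp add: u e_def power2_eq_square)
    moreover have "t * (vnorm w)\<^sup>2 > 0" using t pos by simp
    ultimately show False by linarith
  qed
  then have "w = 0\<^sub>v n" using vnorm_eq_0[OF w] by simp
  then have "w $ i = 0" if "i < n" for i using that by simp
  then show ?thesis using c unfolding w_def by (intro eq_vecI) auto
qed

lemma gradient_eq: "has_gradient h g p \<Longrightarrow> gradient h p = g"
  unfolding gradient_def by (blast intro: has_gradient_unique)

text \<open>The two linear maps are compared on t u; the factor t cancels and leaves |D| <= 2 e |u|
  for every e > 0. The values of G need one common dimension, since only then is their difference a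
  meaningful \<open>real vec\<close>.\<close>

lemma has_jacobian_unique:
  assumes G: "\<And>q. q \<in> carrier_vec n \<Longrightarrow> G q \<in> carrier_vec k" and p: "p \<in> carrier_vec n"
    and "has_jacobian G A p" "has_jacobian G B p"
  shows "A = B"
proof -
  have dims: "dim_vec p = n" "dim_vec (G p) = k" using G[OF p] p by auto
  have A: "A \<in> carrier_mat k n" and B: "B \<in> carrier_mat k n"
    using assms(3,4) by (auto simp: has_jacobian_def dims)
  have eq: "A *\<^sub>v u = B *\<^sub>v u" if u: "u \<in> carrier_vec n" for u
  proof -
    define D where "D = A *\<^sub>v u - B *\<^sub>v u"
    have D: "D \<in> carrier_vec k" using A B u unfolding D_def by simp
    have "vnorm D \<le> 2 * e * vnorm u" if e: "e > 0" for e
    proof (cases "vnorm u = 0")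
      case True
      then have "u = 0\<^sub>v n" using vnorm_eq_0[OF u] by simp
      then have "D = 0\<^sub>v k" using A B by (auto intro!: eq_vecI simp: D_def)
      then show ?thesis using True by simp
    next
      case False
      then have pos: "vnorm u > 0" using vnorm_ge_0[of u] by linarith
      obtain \<delta>1 where d1: "\<delta>1 > 0" "\<And>u. u \<in> carrier_vec n \<Longrightarrow> vnorm u < \<delta>1 \<Longrightarrow>
          vnorm (G (p + u) - G p - A *\<^sub>v u) \<le> e * vnorm u"
        using assms(3) e unfolding has_jacobian_def dims by blast
      obtain \<delta>2 where d2: "\<delta>2 > 0" "\<And>u. u \<in> carrier_vec n \<Longrightarrow> vnorm u < \<delta>2 \<Longrightarrow>
          vnorm (G (p + u) - G p - B *\<^sub>v u) \<le> e * vnorm u"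
        using assms(4) e unfolding has_jacobian_def dims by blast
      define t where "t = min \<delta>1 \<delta>2 / (2 * vnorm u)"
      have t: "t > 0" using d1 d2 pos by (simp add: t_def)
      define v where "v = t \<cdot>\<^sub>v u"
      have v: "v \<in> carrier_vec n" "vnorm v = t * vnorm u" using u t by (auto simp: v_def vnorm_smult)
      have "vnorm v = min \<delta>1 \<delta>2 / 2" using pos by (simp add: v t_def)
      then have small: "vnorm v < \<delta>1" "vnorm v < \<delta>2" using d1(1) d2(1) by auto
      have Gc: "G (p + v) \<in> carrier_vec k" "G p \<in> carrier_vec k" using G p v by auto
      have tD: "t \<cdot>\<^sub>v D = (G (p + v) - G p - B *\<^sub>v v) - (G (p + v) - G p - A *\<^sub>v v)"
        unfolding D_def v_def mult_mat_vec[OF A u] mult_mat_vec[OF B u]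
        using Gc A B u by (intro eq_vecI) (auto simp: algebra_simps v_def)
      have "t * vnorm D = vnorm (t \<cdot>\<^sub>v D)" using t by (simp add: vnorm_smult)
      also have "\<dots> \<le> e * vnorm v + e * vnorm v"
        unfolding tD by (rule order.trans[OF vnorm_diff_le[of _ k] add_mono])
          (use d1(2)[OF v(1) small(1)] d2(2)[OF v(1) small(2)] Gc A B v in auto)
      finally have "t * vnorm D \<le> t * (2 * e * vnorm u)" by (simp add: v mult_ac)
      then show ?thesis using t by simp
    qed
    note bnd = this
    have "vnorm D \<le> 0"
    proof (rule field_le_epsilon)
      fix e :: real assume e: "e > 0"
      show "vnorm D \<le> 0 + e"
      proof -
        define q where "q = e / (2 * (vnorm u + 1))"
        have "vnorm u + 1 > 0" using vnorm_ge_0[of u] by linarith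
        then have q: "q > 0" "2 * q * (vnorm u + 1) = e" using e by (auto simp: q_def field_simps)
        have "vnorm D \<le> 2 * q * vnorm u" by (rule bnd[OF q(1)])
        also have "\<dots> \<le> 2 * q * (vnorm u + 1)" using q(1) by simp
        finally show ?thesis using q by simp
      qed
    qed
    then have "D = 0\<^sub>v k" using vnorm_eq_0[OF D] vnorm_ge_0[of D] by simp
    then have "D $ i = 0" if "i < k" for i using that by simp
    then show ?thesis using A B unfolding D_def by (intro eq_vecI) auto
  qed
  show ?thesis
  proof (rule eq_matI)
    fix i j assume ij: "i < dim_row B" "j < dim_col B"
    then have "(A *\<^sub>v unit_vec n j) $ i = (B *\<^sub>v unit_vec n j) $ i" using eq B by simp
    then show "A $$ (i, j) = B $$ (i, j)" using ij A B by simp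
  qed (use A B in auto)
qed

lemma jacobian_eq:
  assumes "\<And>q. q \<in> carrier_vec n \<Longrightarrow> G q \<in> carrier_vec k" "p \<in> carrier_vec n" "has_jacobian G A p"
  shows "jacobian G p = A"
  unfolding jacobian_def 
proof (rule the_equality)
  show "B = A" if "has_jacobian G B p" for B
    by (rule has_jacobian_unique[OF assms(1,2) that assms(3)])
qed (rule assms(3))

text \<open>Pairing with a fixed v reduces the vector calculus to real functions of one variable,
  for which the mean value theorem, continuity and sign arguments are at hand.\<close>

lemma has_jacobian_along_line:
  assumes G: "\<And>q. q \<in> carrier_vec n \<Longrightarrow> G q \<in> carrier_vec k"
    and p: "p \<in> carrier_vec n" and u: "u \<in> carrier_vec n" and v: "v \<in> carrier_vec k"
    and J: "has_jacobian G A (p + t \<cdot>\<^sub>v u)"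
  shows "((\<lambda>t. v \<bullet> G (p + t \<cdot>\<^sub>v u)) has_real_derivative v \<bullet> (A *\<^sub>v u)) (at t)"
proof -
  define q where "q = p + t \<cdot>\<^sub>v u"
  have q: "q \<in> carrier_vec n" using p u by (auto simp: q_def)
  have dims: "dim_vec q = n" "dim_vec (G q) = k" using G[OF q] q by auto
  have A: "A \<in> carrier_mat k n" using J by (auto simp: has_jacobian_def dims q_def[symmetric])
  \<comment> \<open>The summand 1 keeps the divisor positive when u or v vanishes.\<close>
  define c where "c = vnorm v * vnorm u + 1"
  have c: "c > 0" "vnorm v * vnorm u \<le> c" unfolding c_def
    using mult_nonneg_nonneg[OF vnorm_ge_0[of v] vnorm_ge_0[of u]] by linarith+
  have "\<exists>\<delta>>0. \<forall>s. s \<noteq> t \<and> \<bar>s - t\<bar> < \<delta> \<longrightarrow>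
      \<bar>(v \<bullet> G (p + s \<cdot>\<^sub>v u) - v \<bullet> G (p + t \<cdot>\<^sub>v u)) / (s - t) - v \<bullet> (A *\<^sub>v u)\<bar> \<le> e" if e: "e > 0" for e
  proof -
    define e' where "e' = e / c"
    have e': "e' > 0" "e' * c = e" using e c by (auto simp: e'_def)
    obtain \<delta> where d: "\<delta> > 0" "\<And>w. w \<in> carrier_vec n \<Longrightarrow> vnorm w < \<delta> \<Longrightarrow>
          vnorm (G (q + w) - G q - A *\<^sub>v w) \<le> e' * vnorm w"
      using J e' unfolding has_jacobian_def dims q_def[symmetric] by blast
    have u1: "vnorm u + 1 > 0" using vnorm_ge_0[of u] by linarith
    show ?thesis
    proof (intro exI[of _ "\<delta> / (vnorm u + 1)"] conjI allI impI)
      show "\<delta> / (vnorm u + 1) > 0" using d u1 by simp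
      fix s assume s: "s \<noteq> t \<and> \<bar>s - t\<bar> < \<delta> / (vnorm u + 1)"
      define w where "w = (s - t) \<cdot>\<^sub>v u"
      have w: "w \<in> carrier_vec n" "vnorm w = \<bar>s - t\<bar> * vnorm u" using u by (auto simp: w_def vnorm_smult)
      have "\<bar>s - t\<bar> * vnorm u \<le> \<bar>s - t\<bar> * (vnorm u + 1)" by (simp add: mult_left_mono)
      also have "\<dots> < \<delta>" using s u1 by (simp add: field_simps)
      finally have small: "vnorm w < \<delta>" by (simp add: w)
      have qw: "q + w = p + s \<cdot>\<^sub>v u" using p u unfolding q_def w_def
        by (intro eq_vecI) (auto simp: algebra_simps)
      have Gc: "G (q + w) \<in> carrier_vec k" "G q \<in> carrier_vec k" using G q w by auto
      define r where "r = G (q + w) - G q - A *\<^sub>v w"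
      have r: "r \<in> carrier_vec k" using Gc A w by (auto simp: r_def)
      have "v \<bullet> r = v \<bullet> G (q + w) - v \<bullet> G q - v \<bullet> (A *\<^sub>v w)"
        unfolding r_def using Gc A w v by (simp add: scalar_prod_minus_distrib[of _ k])
      also have "v \<bullet> (A *\<^sub>v w) = (s - t) * (v \<bullet> (A *\<^sub>v u))"
        unfolding w_def mult_mat_vec[OF A u] using v A by simp
      finally have vr: "v \<bullet> G (q + w) - v \<bullet> G q - (s - t) * (v \<bullet> (A *\<^sub>v u)) = v \<bullet> r" by simp
      have "\<bar>v \<bullet> r\<bar> \<le> vnorm v * vnorm r" by (rule abs_scalar_prod_le[OF v r])
      also have "\<dots> \<le> vnorm v * (e' * vnorm w)"
        using d(2)[OF w(1) small] by (intro mult_left_mono) (auto simp: r_def)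
      also have "\<dots> = e' * \<bar>s - t\<bar> * (vnorm v * vnorm u)" by (simp add: w)
      also have "\<dots> \<le> e' * \<bar>s - t\<bar> * c" using c e' by (intro mult_left_mono) auto
      finally have "\<bar>v \<bullet> r\<bar> \<le> e * \<bar>s - t\<bar>" unfolding e'(2)[symmetric] by (simp add: mult_ac)
      moreover have "(v \<bullet> G (p + s \<cdot>\<^sub>v u) - v \<bullet> G (p + t \<cdot>\<^sub>v u)) / (s - t) - v \<bullet> (A *\<^sub>v u)
          = (v \<bullet> r) / (s - t)"
        using s unfolding vr[symmetric] qw q_def[symmetric] by (simp add: field_simps)
      ultimately show "\<bar>(v \<bullet> G (p + s \<cdot>\<^sub>v u) - v \<bullet> G (p + t \<cdot>\<^sub>v u)) / (s - t) - v \<bullet> (A *\<^sub>v u)\<bar> \<le> e"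
        using s by (simp add: field_simps)
    qed
  qed
  note main = this
  show ?thesis unfolding has_field_derivative_iff LIM_def dist_real_def
  proof (intro allI impI)
    fix e :: real assume "e > 0"
    then obtain \<delta> where "\<delta> > 0" "\<forall>s. s \<noteq> t \<and> \<bar>s - t\<bar> < \<delta> \<longrightarrow>
      \<bar>(v \<bullet> G (p + s \<cdot>\<^sub>v u) - v \<bullet> G (p + t \<cdot>\<^sub>v u)) / (s - t) - v \<bullet> (A *\<^sub>v u)\<bar> \<le> e / 2"
      using main[of "e / 2"] by auto
    then show "\<exists>s>0. \<forall>x. x \<noteq> t \<and> \<bar>x - t\<bar> < s \<longrightarrow>
        \<bar>(v \<bullet> G (p + x \<cdot>\<^sub>v u) - v \<bullet> G (p + t \<cdot>\<^sub>v u)) / (x - t) - v \<bullet> (A *\<^sub>v u)\<bar> < e"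
      using \<open>e > 0\<close> by (intro exI[of _ \<delta>]) fastforce
  qed
qed

section \<open>Binary search and the Schur-based solve\<close>

text \<open>The invariant concerns signs at the two ends alone, not the shape of \<open>phi\<close>.
  The alternative l = 0 stands for a lower end that was never evaluated: with shift 0 the matrix may
  be singular.\<close>

lemma bisect_bracket:
  assumes "0 \<le> lo" "lo \<le> hi"
    and "lo = 0 \<or> fst (phi lo) > 0" and "fst (phi hi) \<le> 0"
    and "fst (bisect phi n lo hi) = \<gamma>"
  shows "\<exists>l\<ge>0. l \<le> \<gamma> \<and> \<gamma> - l = (hi - lo) / 2 ^ n \<and> (l = 0 \<or> fst (phi l) > 0) \<and> fst (phi \<gamma>) \<le> 0"
  using assms
proof (induction n arbitrary: lo hi)
  case 0
  then show ?case by (intro exI[of _ lo]) simp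
next
  case (Suc n)
  define mid where "mid = (lo + hi) / 2"
  have mid: "0 \<le> mid" "lo \<le> mid" "mid \<le> hi" "hi - mid = (hi - lo) / 2" "mid - lo = (hi - lo) / 2"
    using Suc.prems by (auto simp: mid_def field_simps)
  show ?case
  proof (cases "fst (phi mid) > 0")
    case True
    then have "fst (bisect phi n mid hi) = \<gamma>"
      using Suc.prems(5) by (simp add: Let_def case_prod_unfold mid_def)
    from Suc.IH[OF _ _ _ _ this] True mid Suc.prems show ?thesis by (simp add: mult.commute)
  next
    case False
    then have "fst (bisect phi n lo mid) = \<gamma>"
      using Suc.prems(5) by (simp add: Let_def case_prod_unfold mid_def)
    from Suc.IH[OF _ _ _ _ this] False mid Suc.prems show ?thesis by (simp add: mult.commute)
  qed
qed

text \<open>True for every \<open>phi\<close>, so one may divide by \<gamma> before anything is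
  known about the bracket.\<close>

lemma bisect_pos: "0 \<le> lo \<Longrightarrow> lo < hi \<Longrightarrow> fst (bisect phi n lo hi) > 0"
proof (induction n arbitrary: lo hi)
  case (Suc n)
  have "fst (bisect phi n ((lo + hi) / 2) hi) > 0" "fst (bisect phi n lo ((lo + hi) / 2)) > 0"
    using Suc.prems by (intro Suc.IH; simp)+
  then show ?case by (simp add: Let_def case_prod_unfold)
qed simp

lemma bisect_cost:
  assumes "\<And>x. snd (phi x) = c"
  shows "snd (bisect phi n lo hi) = real n * c"
proof (induction n arbitrary: lo hi)
  case (Suc n)
  have "snd (phi ((lo + hi) / 2)) = c" by (rule assms)
  moreover have "snd (bisect phi n ((lo + hi) / 2) hi) = real n * c"
    "snd (bisect phi n lo ((lo + hi) / 2)) = real n * c"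
    by (rule Suc.IH)+
  ultimately show ?case by (simp add: Let_def case_prod_unfold algebra_simps)
qed simp

lemma halving_width:
  assumes "\<Gamma> > 0" "tol > 0"
  shows "\<Gamma> / 2 ^ nat \<lceil>log 2 (\<Gamma> / tol)\<rceil> \<le> tol"
proof -
  have "\<Gamma> / tol = 2 powr log 2 (\<Gamma> / tol)" using assms by simp
  \<comment> \<open>If \<Gamma> < tol the logarithm is negative and \<open>nat\<close> yields no
    halving; the inequality still holds.\<close>
  also have "\<dots> \<le> 2 powr real (nat \<lceil>log 2 (\<Gamma> / tol)\<rceil>)"
    by (intro powr_mono) linarith+
  finally show ?thesis using assms by (simp add: powr_realpow field_simps)
qed

lemma binary_search_bracket:
  assumes "\<Gamma> > 0" "tol > 0" "fst (phi \<Gamma>) \<le> 0" "fst (binary_search phi \<Gamma> tol) = \<gamma>"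
  shows "\<gamma> > 0 \<and> fst (phi \<gamma>) \<le> 0 \<and> (\<exists>l\<ge>0. l \<le> \<gamma> \<and> \<gamma> - l \<le> tol \<and> (l = 0 \<or> fst (phi l) > 0))"
  using bisect_bracket[of 0 \<Gamma> phi] bisect_pos[of 0 \<Gamma> phi] halving_width[of \<Gamma> tol] assms
  unfolding binary_search_def by fastforce

section \<open>Monotone matrices and their shifted inverses\<close>

definition monotone_mat :: "nat \<Rightarrow> real mat \<Rightarrow> bool" where
  "monotone_mat n A \<longleftrightarrow> A \<in> carrier_mat n n \<and> (\<forall>u\<in>carrier_vec n. 0 \<le> u \<bullet> (A *\<^sub>v u))"

lemma shift_mult_mat_vec:
  fixes A :: "'a :: comm_ring_1 mat"
  assumes "A \<in> carrier_mat n n" "v \<in> carrier_vec n"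
  shows "(A + c \<cdot>\<^sub>m 1\<^sub>m n) *\<^sub>v v = A *\<^sub>v v + c \<cdot>\<^sub>v v"
proof -
  have "(c \<cdot>\<^sub>m 1\<^sub>m n) *\<^sub>v v = c \<cdot>\<^sub>v v"
    using assms by (intro eq_vecI) auto
  then show ?thesis using assms by (simp add: add_mult_distrib_mat_vec[of _ n n])
qed

text \<open>Pairing with v discards the nonnegative term from A, and Cauchy-Schwarz does the rest.
  This is the bound 1/\<gamma> on the norm of the resolvent, phrased without an inverse; A is in
  general not symmetric, as for the Jacobian of a saddle field.\<close>

lemma monotone_shift_expands:
  assumes A: "monotone_mat n A" and "\<gamma> > 0" and v: "v \<in> carrier_vec n"
  shows "\<gamma> * vnorm v \<le> vnorm (A *\<^sub>v v + \<gamma> \<cdot>\<^sub>v v)"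
proof -
  have Ac: "A \<in> carrier_mat n n" using A by (simp add: monotone_mat_def)
  have "\<gamma> * (vnorm v)\<^sup>2 \<le> v \<bullet> (A *\<^sub>v v) + \<gamma> * (v \<bullet> v)"
    using A v by (simp add: monotone_mat_def vnorm_power2)
  also have "\<dots> = v \<bullet> (A *\<^sub>v v + \<gamma> \<cdot>\<^sub>v v)"
    using v Ac by (simp add: scalar_prod_add_distrib[of _ n])
  also have "\<dots> \<le> vnorm v * vnorm (A *\<^sub>v v + \<gamma> \<cdot>\<^sub>v v)"
    using v Ac by (intro scalar_prod_le) auto
  finally have le: "vnorm v * (\<gamma> * vnorm v) \<le> vnorm v * vnorm (A *\<^sub>v v + \<gamma> \<cdot>\<^sub>v v)"
    by (simp add: power2_eq_square mult_ac)
  show ?thesis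
  proof (cases "vnorm v = 0")
    case False
    then have "vnorm v > 0" using vnorm_ge_0[of v] by linarith
    then show ?thesis using le by simp
  qed simp
qed

text \<open>Here u and v solve the systems with shifts l and \<gamma> for one right-hand side, and
  the resolvent identity reads (A + \<gamma> I)(u - v) = (\<gamma> - l) u. The result carries what
  the search knows at its lower end over to the upper end that it returns.\<close>

lemma resolvent_norm_ratio:
  assumes A: "monotone_mat n A" and l: "0 < l" "l \<le> \<gamma>"
    and u: "u \<in> carrier_vec n" and v: "v \<in> carrier_vec n"
    and eq: "A *\<^sub>v u + l \<cdot>\<^sub>v u = A *\<^sub>v v + \<gamma> \<cdot>\<^sub>v v"
  shows "l * vnorm u \<le> \<gamma> * vnorm v"
proof -
  have Ac: "A \<in> carrier_mat n n" using A by (simp add: monotone_mat_def)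
  have "A *\<^sub>v (u - v) + \<gamma> \<cdot>\<^sub>v (u - v) = (\<gamma> - l) \<cdot>\<^sub>v u"
  proof (rule eq_vecI)
    fix i assume i: "i < dim_vec ((\<gamma> - l) \<cdot>\<^sub>v u)"
    have "(A *\<^sub>v u + l \<cdot>\<^sub>v u) $ i = (A *\<^sub>v v + \<gamma> \<cdot>\<^sub>v v) $ i" using eq by simp
    then show "(A *\<^sub>v (u - v) + \<gamma> \<cdot>\<^sub>v (u - v)) $ i = ((\<gamma> - l) \<cdot>\<^sub>v u) $ i"
      using i u v Ac by (simp add: mult_minus_distrib_mat_vec[OF Ac u v] algebra_simps)
  qed (use u v Ac in auto)
  then have "\<gamma> * vnorm (u - v) \<le> (\<gamma> - l) * vnorm u"
    using monotone_shift_expands[OF A, of \<gamma> "u - v"] u v l by (simp add: vnorm_smult)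
  moreover have "vnorm u \<le> vnorm (u - v) + vnorm v"
  proof -
    have "u = (u - v) + v" using u v by (intro eq_vecI) auto
    then show ?thesis using vnorm_add_le[of "u - v" n v] u v by simp
  qed
  then have "\<gamma> * vnorm u \<le> \<gamma> * vnorm (u - v) + \<gamma> * vnorm v"
    using l by (simp flip: distrib_left)
  ultimately show ?thesis by (simp add: algebra_simps)
qed

lemma monotone_shift_det_nonzero:
  assumes A: "monotone_mat n A" and "\<gamma> > 0"
  shows "det (A + \<gamma> \<cdot>\<^sub>m 1\<^sub>m n) \<noteq> 0"
proof
  have Ac: "A \<in> carrier_mat n n" using A by (simp add: monotone_mat_def)
  assume "det (A + \<gamma> \<cdot>\<^sub>m 1\<^sub>m n) = 0"
  then obtain v where v: "v \<in> carrier_vec n" "v \<noteq> 0\<^sub>v n" "(A + \<gamma> \<cdot>\<^sub>m 1\<^sub>m n) *\<^sub>v v = 0\<^sub>v n"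
    using det_0_iff_vec_prod_zero_field[of "A + \<gamma> \<cdot>\<^sub>m 1\<^sub>m n" n] Ac by auto
  then have "\<gamma> * vnorm v \<le> 0"
    using monotone_shift_expands[OF A \<open>\<gamma> > 0\<close> v(1)] shift_mult_mat_vec[OF Ac v(1)] by simp
  then have "vnorm v \<le> 0" using \<open>\<gamma> > 0\<close> by (simp add: mult_le_0_iff)
  then show False using v vnorm_eq_0[OF v(1)] vnorm_ge_0[of v] by simp
qed

lemma nonsingular_solvable:
  fixes B :: "'a :: field mat"
  assumes B: "B \<in> carrier_mat n n" and "det B \<noteq> 0" and b: "b \<in> carrier_vec n"
  obtains v where "v \<in> carrier_vec n" "B *\<^sub>v v = b"
proof -
  obtain C where C: "C \<in> carrier_mat n n" "B * C = 1\<^sub>m n"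
    using det_non_zero_imp_unit[OF B \<open>det B \<noteq> 0\<close>, unfolded Units_def] by (auto simp: ring_mat_def)
  then have "B *\<^sub>v (C *\<^sub>v b) = b"
    using assoc_mult_mat_vec[OF B C(1) b] b by simp
  then show thesis using C b by (intro that[of "C *\<^sub>v b"]) auto
qed

text \<open>The Schur-based solve is determined by the matrix alone, as unitarity makes the
  triangular system equivalent to the shifted real one.\<close>

lemma schur_solve_correct:
  assumes A: "monotone_mat n A" and "\<gamma> > 0" and b: "b \<in> carrier_vec n"
    and S: "is_schur n A QU"
  shows "schur_solve QU \<gamma> b \<in> carrier_vec n"
    "A *\<^sub>v schur_solve QU \<gamma> b + \<gamma> \<cdot>\<^sub>v schur_solve QU \<gamma> b = b"
proof -
  obtain Q U where QU: "QU = (Q, U)" by force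
  have Ac: "A \<in> carrier_mat n n" using A by (simp add: monotone_mat_def)
  define P where "P = mat_adjoint Q"
  have Q: "Q \<in> carrier_mat n n" and U: "U \<in> carrier_mat n n"
    and QP: "Q * P = 1\<^sub>m n" and PQ: "P * Q = 1\<^sub>m n"
    and dec: "map_mat complex_of_real A = Q * U * P"
    using S by (auto simp: is_schur_def QU P_def)
  have P: "P \<in> carrier_mat n n"
    unfolding P_def mat_adjoint_def using Q by (intro carrier_matI) auto
  define B where "B = A + \<gamma> \<cdot>\<^sub>m 1\<^sub>m n"
  have B: "B \<in> carrier_mat n n" using Ac by (simp add: B_def)
  obtain v where v: "v \<in> carrier_vec n" "B *\<^sub>v v = b"
    using nonsingular_solvable[OF B monotone_shift_det_nonzero[OF A \<open>\<gamma> > 0\<close>, folded B_def] b] .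
  define cB where "cB = map_mat complex_of_real B"
  define V where "V = U + complex_of_real \<gamma> \<cdot>\<^sub>m 1\<^sub>m n"
  have V: "V \<in> carrier_mat n n" using U by (simp add: V_def)
  have cB: "cB \<in> carrier_mat n n" using B by (simp add: cB_def)
  \<comment> \<open>Conjugation over the complex numbers: (A + \<gamma> I) Q = Q (U + \<gamma> I),
    because the adjoint of Q is its inverse.\<close>
  have cBV: "cB *\<^sub>v (Q *\<^sub>v w) = Q *\<^sub>v (V *\<^sub>v w)" if w: "w \<in> carrier_vec n" for w
  proof -
    have "cB = map_mat complex_of_real A + complex_of_real \<gamma> \<cdot>\<^sub>m 1\<^sub>m n"
      using Ac by (intro eq_matI) (auto simp: cB_def B_def)
    then have "cB *\<^sub>v (Q *\<^sub>v w) = (Q * U * P) *\<^sub>v (Q *\<^sub>v w) + complex_of_real \<gamma> \<cdot>\<^sub>v (Q *\<^sub>v w)"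
      using shift_mult_mat_vec[of "map_mat complex_of_real A" n "Q *\<^sub>v w"] Ac Q w
      by (simp add: dec[symmetric])
    also have "(Q * U * P) *\<^sub>v (Q *\<^sub>v w) = (Q * U) *\<^sub>v (P *\<^sub>v (Q *\<^sub>v w))"
      by (rule assoc_mult_mat_vec) (use Q U P w in auto)
    also have "P *\<^sub>v (Q *\<^sub>v w) = w"
      using assoc_mult_mat_vec[OF P Q w] w by (simp add: PQ)
    also have "(Q * U) *\<^sub>v w = Q *\<^sub>v (U *\<^sub>v w)"
      by (rule assoc_mult_mat_vec[OF Q U w])
    also have "complex_of_real \<gamma> \<cdot>\<^sub>v (Q *\<^sub>v w) = Q *\<^sub>v (complex_of_real \<gamma> \<cdot>\<^sub>v w)"
      using mult_mat_vec[OF Q w] by simp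
    finally show ?thesis
      using shift_mult_mat_vec[OF U w] Q U w by (simp add: V_def mult_add_distrib_mat_vec[of _ n n])
  qed
  define cb where "cb = map_vec complex_of_real b"
  define cv where "cv = map_vec complex_of_real v"
  have cbv: "cb \<in> carrier_vec n" "cv \<in> carrier_vec n" using b v by (auto simp: cb_def cv_def)
  have Bcv: "cB *\<^sub>v cv = cb"
    unfolding cb_def cv_def cB_def v(2)[symmetric] by (rule of_real_hom.mult_mat_vec_hom[OF B v(1), symmetric])
  have "det cB \<noteq> 0"
    using monotone_shift_det_nonzero[OF A \<open>\<gamma> > 0\<close>] unfolding cB_def B_def[symmetric]
    by (simp add: of_real_hom.hom_det)
  then have inj: "w = cv" if "w \<in> carrier_vec n" "cB *\<^sub>v w = cb" for w
  proof -
    have "cB *\<^sub>v (w - cv) = 0\<^sub>v n"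
      using that cbv cB Bcv by (simp add: mult_minus_distrib_mat_vec[of _ n n])
    then have "w - cv = 0\<^sub>v n"
      using \<open>det cB \<noteq> 0\<close> det_0_iff_vec_prod_zero_field[OF cB] minus_carrier_vec[OF that(1) cbv(2)] by blast
    then have "(w - cv) $ i = 0" if "i < n" for i using that by simp
    then show ?thesis using that cbv by (intro eq_vecI) auto
  qed
  have QPv: "Q *\<^sub>v (P *\<^sub>v w) = w" and PQv: "P *\<^sub>v (Q *\<^sub>v w) = w" if "w \<in> carrier_vec n" for w
    using that assoc_mult_mat_vec[OF Q P that] assoc_mult_mat_vec[OF P Q that] by (simp_all add: QP PQ)
  \<comment> \<open>\<open>tri_solve\<close> is a definite description. Existence comes from the
    embedded real solution v, uniqueness from the nonzero determinant, and the value is then real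
    because it comes from v.\<close>
  have tri: "tri_solve V (P *\<^sub>v cb) = P *\<^sub>v cv"
    unfolding tri_solve_def
  proof (rule the_equality)
    have "Q *\<^sub>v (V *\<^sub>v (P *\<^sub>v cv)) = cb" using cBV[of "P *\<^sub>v cv"] QPv[OF cbv(2)] P cbv Bcv by simp
    then have "V *\<^sub>v (P *\<^sub>v cv) = P *\<^sub>v cb"
      using PQv[of "V *\<^sub>v (P *\<^sub>v cv)"] V P cbv by simp
    then show "P *\<^sub>v cv \<in> carrier_vec (dim_row V) \<and> V *\<^sub>v (P *\<^sub>v cv) = P *\<^sub>v cb"
      using P V cbv by auto
  next
    fix w assume "w \<in> carrier_vec (dim_row V) \<and> V *\<^sub>v w = P *\<^sub>v cb"
    then have w: "w \<in> carrier_vec n" "V *\<^sub>v w = P *\<^sub>v cb" using V by auto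
    have "Q *\<^sub>v w = cv" by (rule inj) (use w Q cBV[OF w(1)] QPv[OF cbv(1)] in auto)
    then show "w = P *\<^sub>v cv" using PQv[OF w(1)] by simp
  qed
  have "schur_solve QU \<gamma> b = map_vec Re cv"
    using U tri QPv[OF cbv(2)] by (simp add: schur_solve_def QU V_def P_def cb_def)
  also have "\<dots> = v" by (intro eq_vecI) (auto simp: cv_def)
  finally have "schur_solve QU \<gamma> b = v" .
  then show "schur_solve QU \<gamma> b \<in> carrier_vec n"
    "A *\<^sub>v schur_solve QU \<gamma> b + \<gamma> \<cdot>\<^sub>v schur_solve QU \<gamma> b = b"
    using v shift_mult_mat_vec[OF Ac v(1), of \<gamma>] by (auto simp: B_def)
qed

section \<open>Lazy extragradient steps for a monotone field\<close>

lemma gauss_sum_le: "(\<Sum>k<m. real k) \<le> (real m)\<^sup>2 / 2"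
  by (induction m) (auto simp: power2_eq_square field_simps)

text \<open>A displacement inside a period of length \<open>m\<close> accumulates at most \<open>m\<close> increments; counting
  each increment only in the later steps of its own period gives the factor \<open>m\<^sup>2 / 2\<close>.\<close>

lemma sum_lag_square_le:
  fixes r \<delta> :: "nat \<Rightarrow> real"
  assumes m: "m \<ge> 1"
    and \<delta>0: "\<And>i. 0 \<le> \<delta> i"
    and \<delta>: "\<And>i. \<delta> i \<le> (\<Sum>j\<in>{i - i mod m..<i}. r j)"
  shows "(\<Sum>i<T. (\<delta> i)\<^sup>2) \<le> (real m)\<^sup>2 / 2 * (\<Sum>j<T. (r j)\<^sup>2)"
proof -
  define P where "P = (\<lambda>i j. i - i mod m \<le> j \<and> j < i)"
  have one: "(\<delta> i)\<^sup>2 \<le> (\<Sum>j<T. if P i j then real (i mod m) * (r j)\<^sup>2 else 0)" if "i < T" for i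
  proof -
    have "(\<delta> i)\<^sup>2 \<le> (\<Sum>j\<in>{i - i mod m..<i}. r j)\<^sup>2"
      using \<delta>0 \<delta> by (intro power_mono) auto
    \<comment> \<open>Cauchy-Schwarz over the increments since the last snapshot; their number is
      \<open>i mod m\<close>.\<close>
    also have "\<dots> \<le> (\<Sum>j\<in>{i - i mod m..<i}. (r j)\<^sup>2) * real (card {i - i mod m..<i})"
      by (rule sum_squared_le_sum_of_squares)
    also have "card {i - i mod m..<i} = i mod m" by simp
    also have "(\<Sum>j\<in>{i - i mod m..<i}. (r j)\<^sup>2) * real (i mod m)
        = (\<Sum>j\<in>{i - i mod m..<i}. real (i mod m) * (r j)\<^sup>2)"
      by (simp add: sum_distrib_left mult.commute)
    also have "{i - i mod m..<i} = {j\<in>{..<T}. P i j}" using that by (auto simp: P_def)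
    finally show ?thesis by (simp add: sum.If_cases Int_def)
  qed
  have inner: "(\<Sum>i<T. if P i j then real (i mod m) else 0) \<le> (real m)\<^sup>2 / 2" for j
  proof -
    \<comment> \<open>All i that count j lie in the block of j. Their residues modulo m are
      therefore distinct, and the weights add up to at most 0 + 1 + ... + (m - 1).\<close>
    have dv: "i div m = j div m" if "P i j" for i
    proof (rule antisym)
      have "m * (i div m) \<le> j" using that by (simp add: P_def minus_mod_eq_mult_div)
      then show "i div m \<le> j div m" using m by (simp add: less_eq_div_iff_mult_less_eq mult.commute)
      show "j div m \<le> i div m" using that by (intro div_le_mono) (simp add: P_def)
    qed
    have inj: "inj_on (\<lambda>i. i mod m) {i. i < T \<and> P i j}"
    proof (rule inj_onI)
      fix x y assume "x \<in> {i. i < T \<and> P i j}" "y \<in> {i. i < T \<and> P i j}" "x mod m = y mod m"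
      then show "x = y" using dv[of x] dv[of y] by (metis div_mult_mod_eq mem_Collect_eq)
    qed
    have "(\<Sum>i<T. if P i j then real (i mod m) else 0) = (\<Sum>i\<in>{i. i < T \<and> P i j}. real (i mod m))"
      by (simp add: sum.If_cases Int_def)
    also have "\<dots> = (\<Sum>k\<in>(\<lambda>i. i mod m) ` {i. i < T \<and> P i j}. real k)"
      using sum.reindex[OF inj, of real] by simp
    also have "\<dots> \<le> (\<Sum>k<m. real k)"
      using m by (intro sum_mono2) auto
    also have "\<dots> \<le> (real m)\<^sup>2 / 2" by (rule gauss_sum_le)
    finally show ?thesis .
  qed
  have "(\<Sum>i<T. (\<delta> i)\<^sup>2) \<le> (\<Sum>i<T. \<Sum>j<T. if P i j then real (i mod m) * (r j)\<^sup>2 else 0)"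
    using one by (intro sum_mono) auto
  also have "\<dots> = (\<Sum>j<T. \<Sum>i<T. if P i j then real (i mod m) * (r j)\<^sup>2 else 0)"
    by (rule sum.swap)
  also have "\<dots> = (\<Sum>j<T. (r j)\<^sup>2 * (\<Sum>i<T. if P i j then real (i mod m) else 0))"
    by (auto simp: sum_distrib_left intro!: sum.cong)
  also have "\<dots> \<le> (\<Sum>j<T. (r j)\<^sup>2 * ((real m)\<^sup>2 / 2))"
    using inner by (intro sum_mono mult_left_mono) auto
  finally show ?thesis by (simp add: sum_distrib_left mult.commute sum_divide_distrib)
qed

text \<open>The errors feed back into the drift that causes them. Squaring and summing gives 9 m^2 E
  <= 2 S + 2 D; the lag bound gives 2 D <= m^2 R; and R <= 2 S + 2 E. Hence 9 E <= 4 S + 2 E. The 9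
  is the square of the 3 in M = 3 \<rho> m, chosen large enough for a ratio below 1.\<close>

lemma lazy_error_sum_le:
  fixes a e r \<delta> :: "nat \<Rightarrow> real"
  assumes m: "m \<ge> 1" and nonneg: "\<And>i. 0 \<le> e i" "\<And>i. 0 \<le> \<delta> i" "\<And>i. 0 \<le> r i"
    and e: "\<And>i. i < T \<Longrightarrow> 3 * real m * e i \<le> a i + \<delta> i"
    and r: "\<And>i. i < T \<Longrightarrow> r i \<le> a i + e i"
    and \<delta>: "\<And>i. \<delta> i \<le> (\<Sum>j\<in>{i - i mod m..<i}. r j)"
  shows "(\<Sum>i<T. (e i)\<^sup>2) \<le> 4/7 * (\<Sum>i<T. (a i)\<^sup>2)"
proof -
  define E S R D where "E = (\<Sum>i<T. (e i)\<^sup>2)" and "S = (\<Sum>i<T. (a i)\<^sup>2)"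
    and "R = (\<Sum>i<T. (r i)\<^sup>2)" and "D = (\<Sum>i<T. (\<delta> i)\<^sup>2)"
  have sq: "(x + y)\<^sup>2 \<le> 2 * x\<^sup>2 + 2 * y\<^sup>2" for x y :: real
    using sum_squares_ge_zero[of "x - y" 0] by (simp add: power2_eq_square algebra_simps)
  have "9 * (real m)\<^sup>2 * (e i)\<^sup>2 \<le> 2 * (a i)\<^sup>2 + 2 * (\<delta> i)\<^sup>2" if "i < T" for i
  proof -
    have "(3 * real m * e i)\<^sup>2 \<le> (a i + \<delta> i)\<^sup>2"
      using e[OF that] nonneg by (intro power_mono) auto
    also have "\<dots> \<le> 2 * (a i)\<^sup>2 + 2 * (\<delta> i)\<^sup>2" by (rule sq)
    finally show ?thesis by (simp add: power_mult_distrib)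
  qed
  then have "(\<Sum>i<T. 9 * (real m)\<^sup>2 * (e i)\<^sup>2) \<le> (\<Sum>i<T. 2 * (a i)\<^sup>2 + 2 * (\<delta> i)\<^sup>2)"
    by (intro sum_mono) auto
  then have "9 * (real m)\<^sup>2 * E \<le> 2 * S + 2 * D"
    by (simp add: E_def S_def D_def sum_distrib_left sum.distrib)
  also have "\<dots> \<le> 2 * S + (real m)\<^sup>2 * R"
    using sum_lag_square_le[of m \<delta> r T, OF m nonneg(2) \<delta>] by (simp add: D_def R_def)
  \<comment> \<open>Enlarging S by m^2 >= 1 lets m^2 cancel throughout.\<close>
  also have "2 * S \<le> (real m)\<^sup>2 * (2 * S)"
  proof -
    have "1 * (2 * S) \<le> (real m)\<^sup>2 * (2 * S)"
      using m by (intro mult_right_mono) (auto simp: S_def sum_nonneg one_le_power)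
    then show ?thesis by simp
  qed
  finally have "(real m)\<^sup>2 * (9 * E) \<le> (real m)\<^sup>2 * (2 * S + R)" by (simp add: algebra_simps)
  then have "9 * E \<le> 2 * S + R" using m by simp
  moreover have "R \<le> 2 * S + 2 * E"
  proof -
    have "(r i)\<^sup>2 \<le> 2 * (a i)\<^sup>2 + 2 * (e i)\<^sup>2" if "i < T" for i
      using order.trans[OF power_mono[OF r[OF that] nonneg(3)] sq] .
    then have "R \<le> (\<Sum>i<T. 2 * (a i)\<^sup>2 + 2 * (e i)\<^sup>2)"
      unfolding R_def by (intro sum_mono) auto
    then show ?thesis by (simp add: S_def E_def sum_distrib_left sum.distrib)
  qed
  ultimately show ?thesis unfolding E_def S_def by simp
qed

text \<open>What the convergence argument takes from the saddle field. The Lipschitz condition is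
  stated on vectors, which keeps the spectral norm out; \<open>minty\<close> compares with the
  single solution \<open>zs\<close> only.\<close>

locale monotone_field =
  fixes n :: nat and F :: "real vec \<Rightarrow> real vec" and DF :: "real vec \<Rightarrow> real mat"
    and \<rho> :: real and zs :: "real vec"
  assumes F_carrier: "z \<in> carrier_vec n \<Longrightarrow> F z \<in> carrier_vec n"
    and DF_jacobian: "z \<in> carrier_vec n \<Longrightarrow> has_jacobian F (DF z) z"
    and DF_monotone: "z \<in> carrier_vec n \<Longrightarrow> monotone_mat n (DF z)"
    and DF_lipschitz: "p \<in> carrier_vec n \<Longrightarrow> q \<in> carrier_vec n \<Longrightarrow> u \<in> carrier_vec n \<Longrightarrow>
        vnorm (DF p *\<^sub>v u - DF q *\<^sub>v u) \<le> \<rho> * vnorm (p - q) * vnorm u"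
    and rho_pos: "\<rho> > 0"
    and zs_carrier: "zs \<in> carrier_vec n"
    and F_zs: "F zs = 0\<^sub>v n"
    and minty: "z \<in> carrier_vec n \<Longrightarrow> 0 \<le> F z \<bullet> (z - zs)"
begin

lemma DF_carrier: "z \<in> carrier_vec n \<Longrightarrow> DF z \<in> carrier_mat n n"
  using DF_monotone by (simp add: monotone_mat_def)

text \<open>The mean value theorem fails for vector-valued maps, so it is applied to the pairing of
  F with the remainder r itself along the segment from z to z - v. This gives |r|^2 = r . (DF w - DF
  q) v for some q on the segment, where |w - q| <= |v| + |z - w|, and one factor |r|
  cancels.\<close>

lemma lazy_taylor_bound:
  assumes z: "z \<in> carrier_vec n" and v: "v \<in> carrier_vec n" and w: "w \<in> carrier_vec n"
  shows "vnorm (F (z - v) - F z + DF w *\<^sub>v v) \<le> \<rho> * (vnorm v + vnorm (z - w)) * vnorm v"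
proof -
  define r where "r = F (z - v) - F z + DF w *\<^sub>v v"
  note [simp] = F_carrier DF_carrier minus_carrier_vec mult_mat_vec_carrier[OF DF_carrier]
  have r: "r \<in> carrier_vec n" using z v w by (simp add: r_def)
  define h where "h = (\<lambda>t. r \<bullet> F (z + t \<cdot>\<^sub>v (- v)))"
  have der: "(h has_real_derivative r \<bullet> (DF (z + t \<cdot>\<^sub>v (- v)) *\<^sub>v (- v))) (at t)" for t
    unfolding h_def by (rule has_jacobian_along_line[of n _ n]) (use z v r DF_jacobian F_carrier in auto)
  obtain \<xi> where \<xi>: "0 < \<xi>" "\<xi> < 1" "h 1 - h 0 = (1 - 0) * (r \<bullet> (DF (z + \<xi> \<cdot>\<^sub>v (- v)) *\<^sub>v (- v)))"
    using MVT2[of 0 1 h "\<lambda>t. r \<bullet> (DF (z + t \<cdot>\<^sub>v (- v)) *\<^sub>v (- v))"] der by auto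
  define q where "q = z + \<xi> \<cdot>\<^sub>v (- v)"
  have q: "q \<in> carrier_vec n" using z v by (simp add: q_def)
  have neg: "DF q *\<^sub>v (- v) = - (DF q *\<^sub>v v)"
  proof -
    have "- v = (-1) \<cdot>\<^sub>v v" using v by (intro eq_vecI) auto
    then have "DF q *\<^sub>v (- v) = (-1) \<cdot>\<^sub>v (DF q *\<^sub>v v)" using mult_mat_vec[OF DF_carrier[OF q] v] by simp
    then show ?thesis using q v by (auto intro!: eq_vecI)
  qed
  have z1: "z + 1 \<cdot>\<^sub>v (- v) = z - v" "z + 0 \<cdot>\<^sub>v (- v) = z" using z v by (auto intro!: eq_vecI)
  have "(vnorm r)\<^sup>2 = r \<bullet> (F (z - v) - F z + DF w *\<^sub>v v)" by (simp add: vnorm_power2 r_def)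
  also have "\<dots> = r \<bullet> F (z - v) - r \<bullet> F z + r \<bullet> (DF w *\<^sub>v v)"
    using z v w r by (simp add: scalar_prod_add_distrib[of _ n] scalar_prod_minus_distrib[of _ n])
  also have "r \<bullet> F (z - v) - r \<bullet> F z = - (r \<bullet> (DF q *\<^sub>v v))"
  proof -
    have "h 1 = r \<bullet> F (z - v)" "h 0 = r \<bullet> F z" unfolding h_def z1 by (rule refl)+
    moreover have "r \<bullet> (- (DF q *\<^sub>v v)) = - (r \<bullet> (DF q *\<^sub>v v))"
      using q v r by (intro scalar_prod_uminus_right) (simp add: carrier_matD[OF DF_carrier])
    ultimately show ?thesis using \<xi>(3) by (simp only: q_def[symmetric] neg) simp
  qed
  also have "- (r \<bullet> (DF q *\<^sub>v v)) + r \<bullet> (DF w *\<^sub>v v) = r \<bullet> (DF w *\<^sub>v v - DF q *\<^sub>v v)"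
    using q w v r by (simp add: scalar_prod_minus_distrib[of _ n])
  also have "\<dots> \<le> vnorm r * vnorm (DF w *\<^sub>v v - DF q *\<^sub>v v)"
    using q w v r by (intro scalar_prod_le) auto
  also have "\<dots> \<le> vnorm r * (\<rho> * vnorm (w - q) * vnorm v)"
    using DF_lipschitz[OF w q v] by (intro mult_left_mono) auto
  also have "\<dots> \<le> vnorm r * (\<rho> * (vnorm v + vnorm (z - w)) * vnorm v)"
  proof -
    have "vnorm (w - q) \<le> vnorm (w - z) + vnorm (z - q)" using vnorm_diff_triangle[OF w z q] .
    moreover have "z - q = \<xi> \<cdot>\<^sub>v v" using z v by (auto intro!: eq_vecI simp: q_def)
    then have "vnorm (z - q) \<le> vnorm v" using \<xi> by (simp add: vnorm_smult mult_left_le_one_le)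
    ultimately have "vnorm (w - q) \<le> vnorm v + vnorm (z - w)"
      using vnorm_minus_commute[OF w z] by simp
    then show ?thesis using rho_pos by (intro mult_left_mono mult_right_mono) auto
  qed
  finally have le: "vnorm r * vnorm r \<le> vnorm r * (\<rho> * (vnorm v + vnorm (z - w)) * vnorm v)"
    by (simp add: power2_eq_square)
  show ?thesis
  proof (cases "vnorm r = 0")
    case True
    then show ?thesis using rho_pos by (simp add: r_def)
  next
    case False
    then have "vnorm r > 0" using vnorm_ge_0[of r] by linarith
    then show ?thesis using le by (simp add: r_def)
  qed
qed

text \<open>Compares the regularised Newton step with the exact displacement to the solution, which
  bounds the bracket needed by the binary search independently of the field.\<close>

lemma lazy_newton_step_bound:
  assumes z: "z \<in> carrier_vec n" "vnorm (z - zs) \<le> \<beta>"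
    and w: "w \<in> carrier_vec n" "vnorm (w - zs) \<le> \<beta>"
    and v: "v \<in> carrier_vec n" and \<gamma>: "\<gamma> > 0"
    and eq: "DF w *\<^sub>v v + \<gamma> \<cdot>\<^sub>v v = F z"
  shows "\<gamma> * vnorm v \<le> 2 * \<gamma> * \<beta> + 3 * \<rho> * \<beta>\<^sup>2"
proof -
  note [simp] = F_carrier DF_carrier minus_carrier_vec mult_mat_vec_carrier[OF DF_carrier]
  have \<beta>: "\<beta> \<ge> 0" using z(2) vnorm_ge_0[of "z - zs"] by linarith
  define q where "q = z - zs"
  have q: "q \<in> carrier_vec n" using z zs_carrier by (simp add: q_def)
  have "z - q = zs" using z zs_carrier by (auto intro!: eq_vecI simp: q_def)
  then have tay: "vnorm (0\<^sub>v n - F z + DF w *\<^sub>v q) \<le> \<rho> * (vnorm q + vnorm (z - w)) * vnorm q"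
    using lazy_taylor_bound[OF z(1) q w(1)] by (simp add: F_zs)
  also have "\<dots> \<le> \<rho> * (\<beta> + 2 * \<beta>) * \<beta>"
  proof -
    have "vnorm (z - w) \<le> vnorm (z - zs) + vnorm (zs - w)"
      using vnorm_diff_triangle[OF z(1) zs_carrier w(1)] .
    then have "vnorm (z - w) \<le> 2 * \<beta>" using z w vnorm_minus_commute[OF w(1) zs_carrier] by simp
    then show ?thesis using z(2) rho_pos \<beta> by (intro mult_mono add_mono) (auto simp: q_def)
  qed
  finally have tay: "vnorm (0\<^sub>v n - F z + DF w *\<^sub>v q) \<le> 3 * \<rho> * \<beta>\<^sup>2"
    by (simp add: power2_eq_square algebra_simps)
  \<comment> \<open>As F vanishes at \<open>zs\<close>, q = z - zs nearly solves the equation of v: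
    its residual is the Taylor remainder plus \<gamma> q. Monotonicity then bounds \<gamma> |v -
    q|.\<close>
  have "DF w *\<^sub>v (v - q) + \<gamma> \<cdot>\<^sub>v (v - q) = - ((0\<^sub>v n - F z + DF w *\<^sub>v q) + \<gamma> \<cdot>\<^sub>v q)"
  proof -
    define a b where "a = DF w *\<^sub>v v" and "b = DF w *\<^sub>v q"
    have "dim_vec a = n" "dim_vec b = n" using w by (auto simp: a_def b_def carrier_matD[OF DF_carrier])
    then show ?thesis
      unfolding eq[symmetric] mult_minus_distrib_mat_vec[OF DF_carrier[OF w(1)] v q]
        a_def[symmetric] b_def[symmetric]
      using v q by (intro eq_vecI) (auto simp: algebra_simps)
  qed
  then have "\<gamma> * vnorm (v - q) \<le> vnorm ((0\<^sub>v n - F z + DF w *\<^sub>v q) + \<gamma> \<cdot>\<^sub>v q)"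
    using monotone_shift_expands[OF DF_monotone[OF w(1)] \<gamma>, of "v - q"] v q by simp
  also have "\<dots> \<le> 3 * \<rho> * \<beta>\<^sup>2 + \<gamma> * \<beta>"
  proof -
    have "\<gamma> * vnorm q \<le> \<gamma> * \<beta>" using z(2) \<gamma> by (simp add: q_def)
    moreover have "vnorm ((0\<^sub>v n - F z + DF w *\<^sub>v q) + \<gamma> \<cdot>\<^sub>v q)
        \<le> vnorm (0\<^sub>v n - F z + DF w *\<^sub>v q) + \<gamma> * vnorm q"
      using vnorm_add_le[of "0\<^sub>v n - F z + DF w *\<^sub>v q" n "\<gamma> \<cdot>\<^sub>v q"] z w q \<gamma>
      by (simp add: vnorm_smult)
    ultimately show ?thesis using tay by linarith
  qed
  finally have 1: "\<gamma> * vnorm (v - q) \<le> 3 * \<rho> * \<beta>\<^sup>2 + \<gamma> * \<beta>" .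
  have "v = (v - q) + q" using v q by (intro eq_vecI) auto
  then have "vnorm v \<le> vnorm (v - q) + \<beta>"
    using vnorm_add_le[of "v - q" n q] v q z(2) by (simp add: q_def)
  then have "\<gamma> * vnorm v \<le> \<gamma> * vnorm (v - q) + \<gamma> * \<beta>" using \<gamma> by (simp flip: distrib_left)
  then show ?thesis using 1 by simp
qed

text \<open>Since v solves the shifted system, \<gamma> times the error is exactly the lazy Taylor
  remainder. That remainder carries a factor \<rho> |v|, which the lower bound on \<gamma> turns
  into 1 / (3 m).\<close>

lemma lazy_step_error:
  assumes z: "z \<in> carrier_vec n" and w: "w \<in> carrier_vec n" and v: "v \<in> carrier_vec n"
    and \<gamma>: "\<gamma> > 0" "3 * \<rho> * real m * vnorm v \<le> \<gamma>"
    and eq: "DF w *\<^sub>v v + \<gamma> \<cdot>\<^sub>v v = F z"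
  shows "3 * real m * vnorm ((1 / \<gamma>) \<cdot>\<^sub>v F (z - v) - v) \<le> vnorm v + vnorm (z - w)"
proof -
  note [simp] = F_carrier DF_carrier minus_carrier_vec mult_mat_vec_carrier[OF DF_carrier]
  define \<epsilon> where "\<epsilon> = (1 / \<gamma>) \<cdot>\<^sub>v F (z - v) - v"
  have "\<gamma> \<cdot>\<^sub>v \<epsilon> = F (z - v) - F z + DF w *\<^sub>v v"
  proof -
    define a g where "a = DF w *\<^sub>v v" and "g = F (z - v)"
    have "dim_vec a = n" "g \<in> carrier_vec n" using w z v by (auto simp: a_def g_def carrier_matD[OF DF_carrier])
    then show ?thesis
      unfolding eq[symmetric] \<epsilon>_def a_def[symmetric] g_def[symmetric]
      using v \<gamma> by (intro eq_vecI) (auto simp: field_simps)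
  qed
  then have "\<gamma> * vnorm \<epsilon> = vnorm (F (z - v) - F z + DF w *\<^sub>v v)"
    using vnorm_smult[of \<gamma> \<epsilon>] \<gamma> by simp
  then have le: "\<gamma> * vnorm \<epsilon> \<le> \<rho> * (vnorm v + vnorm (z - w)) * vnorm v"
    using lazy_taylor_bound[OF z v w] by simp
  show ?thesis unfolding \<epsilon>_def[symmetric]
  \<comment> \<open>The factor |v| is cancelled below; for v = 0 the remainder bound already makes
    the error vanish.\<close>
  proof (cases "vnorm v = 0")
    case True
    then have "\<gamma> * vnorm \<epsilon> \<le> 0" using le by simp
    then have "vnorm \<epsilon> \<le> 0" using \<gamma> by (simp add: mult_le_0_iff)
    then have "vnorm \<epsilon> = 0" using vnorm_ge_0[of \<epsilon>] by linarith
    then show "3 * real m * vnorm \<epsilon> \<le> vnorm v + vnorm (z - w)" by simp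
  next
    case False
    then have pos: "vnorm v > 0" using vnorm_ge_0[of v] by linarith
    have "(3 * \<rho> * real m * vnorm v) * vnorm \<epsilon> \<le> \<gamma> * vnorm \<epsilon>" using \<gamma> by (intro mult_right_mono) auto
    then have "(\<rho> * vnorm v) * (3 * real m * vnorm \<epsilon>) \<le> (\<rho> * vnorm v) * (vnorm v + vnorm (z - w))"
      using le by (simp add: mult_ac)
    then show "3 * real m * vnorm \<epsilon> \<le> vnorm v + vnorm (z - w)" using pos rho_pos by simp
  qed
qed

end

text \<open>Expanding |z - w - c g|^2 leaves c^2 |g|^2, which is completed to |c g - v|^2 - |v|^2.
  The cross term 2 c g . v moves the pairing from z to the half step z - v.\<close>

lemma extragradient_identity:
  fixes z v w g :: "real vec"
  assumes c: "z \<in> carrier_vec n" "v \<in> carrier_vec n" "w \<in> carrier_vec n" "g \<in> carrier_vec n"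
  shows "(vnorm (z - c \<cdot>\<^sub>v g - w))\<^sup>2 = (vnorm (z - w))\<^sup>2 - 2 * c * (g \<bullet> (z - v - w))
      + (vnorm (c \<cdot>\<^sub>v g - v))\<^sup>2 - (vnorm v)\<^sup>2"
proof -
  have d: "dim_vec z = n" "dim_vec v = n" "dim_vec w = n" "dim_vec g = n" using c by auto
  have "(\<Sum>i<n. (z $ i - c * g $ i - w $ i) * (z $ i - c * g $ i - w $ i))
     = (\<Sum>i<n. (z $ i - w $ i) * (z $ i - w $ i) - 2 * c * (g $ i * (z $ i - v $ i - w $ i))
        + (c * g $ i - v $ i) * (c * g $ i - v $ i) - v $ i * v $ i)"
    by (intro sum.cong refl) (simp add: algebra_simps)
  then show ?thesis
    unfolding vnorm_power2 scalar_prod_def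
    by (simp add: d sum.distrib sum_subtractf sum_distrib_left atLeast0LessThan)
qed

section \<open>Descent, boundedness and regret along a run\<close>

context monotone_field
begin

text \<open>\<open>search\<close> is conditional: the bracket is known to be valid at step t only if
  all iterates up to t lie within \<beta> of the solution. \<open>run_bounded\<close> removes the
  condition.\<close>

context
  fixes z v :: "nat \<Rightarrow> real vec" and \<gamma> :: "nat \<Rightarrow> real" and m :: nat and \<beta> :: real
  assumes m: "m \<ge> 1"
    and zc: "\<And>t. z t \<in> carrier_vec n" and vc: "\<And>t. v t \<in> carrier_vec n"
    and \<gamma>_pos: "\<And>t. \<gamma> t > 0"
    and solve: "\<And>t. DF (z (t - t mod m)) *\<^sub>v v t + \<gamma> t \<cdot>\<^sub>v v t = F (z t)"
    and step: "\<And>t. z (Suc t) = z t - (1 / \<gamma> t) \<cdot>\<^sub>v F (z t - v t)"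
    and search: "\<And>t. (\<And>i. i \<le> t \<Longrightarrow> vnorm (z i - zs) \<le> \<beta>) \<Longrightarrow> 3 * \<rho> * real m * vnorm (v t) \<le> \<gamma> t"
    and start: "vnorm (z 0 - zs) \<le> \<beta>"
begin

text \<open>The one-step identities telescope, and the error sum eats 4/7 of the sum of |v|^2. The
  point w stays free: the solution yields boundedness, other points yield the regret. The weight
  hypothesis reaches only below T so that the lemma can serve inside the induction.\<close>

lemma run_descent:
  assumes "\<And>i. i < T \<Longrightarrow> 3 * \<rho> * real m * vnorm (v i) \<le> \<gamma> i" and w: "w \<in> carrier_vec n"
  shows "(vnorm (z T - w))\<^sup>2 + (\<Sum>i<T. 2 / \<gamma> i * (F (z i - v i) \<bullet> (z i - v i - w)))
      + 3/7 * (\<Sum>i<T. (vnorm (v i))\<^sup>2) \<le> (vnorm (z 0 - w))\<^sup>2"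
proof -
  note [simp] = F_carrier DF_carrier minus_carrier_vec zc vc
  define e where "e = (\<lambda>i. vnorm ((1 / \<gamma> i) \<cdot>\<^sub>v F (z i - v i) - v i))"
  define r where "r = (\<lambda>i. vnorm (z (Suc i) - z i))"
  define \<delta> where "\<delta> = (\<lambda>i. vnorm (z i - z (i - i mod m)))"
  have path: "vnorm (z (i + k) - z i) \<le> (\<Sum>j\<in>{i..<i + k}. r j)" for i k
  proof (induction k)
    case 0
    have "vnorm (z i - z i) = 0" by (simp only: minus_cancel_vec[OF zc] vnorm_zero)
    then show ?case by simp
  next
    case (Suc k)
    then show ?case using vnorm_diff_triangle[OF zc zc zc, of "Suc (i + k)" i "i + k"] by (simp add: r_def)
  qed
  have "(\<Sum>i<T. (e i)\<^sup>2) \<le> 4/7 * (\<Sum>i<T. (vnorm (v i))\<^sup>2)"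
  proof (rule lazy_error_sum_le[OF m, where \<delta> = \<delta> and r = r])
    fix i assume "i < T"
    then show "3 * real m * e i \<le> vnorm (v i) + \<delta> i"
      unfolding e_def \<delta>_def by (intro lazy_step_error assms \<gamma>_pos solve zc vc)
    \<comment> \<open>The true increment differs from -v by the error of the step, so the drift is
      bounded by |v| plus that error.\<close>
    have "z (Suc i) - z i = - (((1 / \<gamma> i) \<cdot>\<^sub>v F (z i - v i) - v i) + v i)"
      unfolding step[of i] by (intro eq_vecI) (auto simp: carrier_vecD[OF zc] carrier_vecD[OF vc]
        carrier_vecD[OF F_carrier[OF minus_carrier_vec[OF zc vc]]])
    then show "r i \<le> vnorm (v i) + e i"
      unfolding r_def e_def
      using vnorm_add_le[of "(1 / \<gamma> i) \<cdot>\<^sub>v F (z i - v i) - v i" n "v i"] by simp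
  next
    fix i
    show "\<delta> i \<le> (\<Sum>j\<in>{i - i mod m..<i}. r j)"
      using path[of "i - i mod m" "i mod m"] by (simp add: \<delta>_def)
  qed (auto simp: e_def r_def \<delta>_def)
  moreover have "(vnorm (z T - w))\<^sup>2 = (vnorm (z 0 - w))\<^sup>2
      - (\<Sum>i<T. 2 / \<gamma> i * (F (z i - v i) \<bullet> (z i - v i - w))) + (\<Sum>i<T. (e i)\<^sup>2) - (\<Sum>i<T. (vnorm (v i))\<^sup>2)"
  proof (induction T)
    case (Suc T)
    have "(vnorm (z (Suc T) - w))\<^sup>2 = (vnorm (z T - w))\<^sup>2
        - 2 / \<gamma> T * (F (z T - v T) \<bullet> (z T - v T - w)) + (e T)\<^sup>2 - (vnorm (v T))\<^sup>2"
      using extragradient_identity[OF zc vc w, of "F (z T - v T)" T "1 / \<gamma> T" T]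
      by (simp add: step e_def)
    then show ?case using Suc by simp
  qed simp
  ultimately show ?thesis by simp
qed

lemma minty_sum_nonneg: "0 \<le> (\<Sum>i<T. 2 / \<gamma> i * (F (z i - v i) \<bullet> (z i - v i - zs)))"
  by (intro sum_nonneg mult_nonneg_nonneg minty) (auto simp: zc vc \<gamma>_pos less_imp_le)

lemma step_sum_nonneg: "0 \<le> (\<Sum>i<T. (vnorm (v i))\<^sup>2)"
  by (simp add: sum_nonneg)

text \<open>Strong induction: \<open>search\<close> at each i < t asks only for iterates up to i,
  and descent towards \<open>zs\<close> then bounds iterate t.\<close>

lemma run_bounded: "vnorm (z t - zs) \<le> \<beta>"
proof (induction t rule: less_induct)
  case (less t)
  show ?case
  proof (cases "t = 0")
    case False
    have "3 * \<rho> * real m * vnorm (v i) \<le> \<gamma> i" if "i < t" for i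
      using that less by (intro search) auto
    from run_descent[of t, OF this zs_carrier]
    have "(vnorm (z t - zs))\<^sup>2 \<le> (vnorm (z 0 - zs))\<^sup>2"
      using minty_sum_nonneg[of t] step_sum_nonneg[of t] by linarith
    then show ?thesis using start power2_le_imp_le[OF _ vnorm_ge_0] by (meson order.trans)
  qed (simp add: start)
qed

lemma run_weight_bound: "3 * \<rho> * real m * vnorm (v t) \<le> \<gamma> t"
  by (intro search run_bounded)

lemma run_step_sum: "(\<Sum>i<T. (vnorm (v i))\<^sup>2) \<le> 7/3 * \<beta>\<^sup>2"
proof -
  have "(vnorm (z 0 - zs))\<^sup>2 \<le> \<beta>\<^sup>2" using start by (intro power_mono) auto
  then show ?thesis
    using run_descent[OF run_weight_bound zs_carrier, of T] minty_sum_nonneg[of T]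
      zero_le_power2[of "vnorm (z T - zs)"] by linarith
qed

text \<open>A single term of the step sum gives |v|^2 <= 7/3 \<beta>^2 <= (2 \<beta>)^2. The
  resulting 3 \<beta> is the source of the 3 in the gap radius.\<close>

lemma run_half_bounded: "vnorm (z t - v t - zs) \<le> 3 * \<beta>"
proof -
  have \<beta>: "\<beta> \<ge> 0" using start vnorm_ge_0 order.trans by blast
  have "(vnorm (v t))\<^sup>2 \<le> (\<Sum>i<Suc t. (vnorm (v i))\<^sup>2)" by (simp add: sum_nonneg)
  also have "\<dots> \<le> 7/3 * \<beta>\<^sup>2" by (rule run_step_sum)
  also have "\<dots> \<le> (2 * \<beta>)\<^sup>2" by (simp add: power_mult_distrib)
  finally have "vnorm (v t) \<le> 2 * \<beta>" 
    using \<beta> by (intro power2_le_imp_le[of "vnorm (v t)" "2 * \<beta>"]) auto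
  moreover have "z t - v t - zs = (z t - zs) - v t"
    using zc vc zs_carrier by (intro eq_vecI) (auto simp: carrier_vecD[OF zc] carrier_vecD[OF vc])
  then have "vnorm (z t - v t - zs) \<le> vnorm (z t - zs) + vnorm (v t)"
    using vnorm_diff_le[of "z t - zs" n "v t"] zc vc zs_carrier by simp
  ultimately show ?thesis using run_bounded[of t] by simp
qed

lemma run_regret:
  assumes w: "w \<in> carrier_vec n"
  shows "(\<Sum>i<T. 1 / \<gamma> i * (F (z i - v i) \<bullet> (z i - v i - w))) \<le> (vnorm (z 0 - w))\<^sup>2 / 2"
proof -
  have "(\<Sum>i<T. 2 / \<gamma> i * (F (z i - v i) \<bullet> (z i - v i - w)))
      = 2 * (\<Sum>i<T. 1 / \<gamma> i * (F (z i - v i) \<bullet> (z i - v i - w)))"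
    by (simp add: sum_distrib_left mult.assoc[symmetric])
  then show ?thesis
    using run_descent[OF run_weight_bound w, of T] zero_le_power2[of "vnorm (z T - w)"]
      step_sum_nonneg[of T] by linarith
qed

end

end

section \<open>The field of a convex-concave function\<close>

lemma convex_gradient_le:
  assumes conv: "convex_fun n h" and g: "has_gradient h g p"
    and p: "p \<in> carrier_vec n" and q: "q \<in> carrier_vec n"
  shows "g \<bullet> (q - p) \<le> h q - h p"
proof -
  have dp: "dim_vec p = n" using p by simp
  have gc: "g \<in> carrier_vec n" using g by (simp add: has_gradient_def dp)
  define u where "u = q - p"
  have u: "u \<in> carrier_vec n" using p q by (simp add: u_def minus_carrier_vec)
  define c where "c = vnorm u + 1"
  have c: "c > 0" "vnorm u < c" using vnorm_ge_0[of u] unfolding c_def by linarith+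
  have "g \<bullet> u \<le> h q - h p + e" if e: "e > 0" for e
  proof -
    have "e / c > 0" using e c by simp
    then obtain \<delta> where d: "\<delta> > 0" "\<And>u. u \<in> carrier_vec n \<Longrightarrow> vnorm u < \<delta> \<Longrightarrow>
        \<bar>h (p + u) - h p - g \<bullet> u\<bar> \<le> e / c * vnorm u"
      using g unfolding has_gradient_def dp by blast
    \<comment> \<open>Short enough to stay on the segment from p to q and inside the radius where
      the gradient estimate holds.\<close>
    define t where "t = min 1 (\<delta> / c)"
    have t: "0 < t" "t \<le> 1" "t * c \<le> \<delta>" using d c by (auto simp: t_def field_simps min_def)
    have "vnorm (t \<cdot>\<^sub>v u) = t * vnorm u" using t by (simp add: vnorm_smult)
    also have "\<dots> < t * c" using t c by simp
    finally have "vnorm (t \<cdot>\<^sub>v u) < \<delta>" using t by simp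
    then have "\<bar>h (p + t \<cdot>\<^sub>v u) - h p - g \<bullet> (t \<cdot>\<^sub>v u)\<bar> \<le> e / c * vnorm (t \<cdot>\<^sub>v u)"
      using d u by simp
    also have "\<dots> \<le> e / c * (t * c)"
      using t c e by (intro mult_left_mono) (auto simp: vnorm_smult)
    finally have "t * (g \<bullet> u) \<le> h (p + t \<cdot>\<^sub>v u) - h p + t * e"
      using gc u c by (simp add: abs_le_iff mult.commute)
    moreover have "h (p + t \<cdot>\<^sub>v u) \<le> t * h q + (1 - t) * h p"
    proof -
      have "p + t \<cdot>\<^sub>v u = t \<cdot>\<^sub>v q + (1 - t) \<cdot>\<^sub>v p"
        using p q by (intro eq_vecI) (auto simp: u_def algebra_simps)
      then show ?thesis using conv p q t by (simp add: convex_fun_def)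
    qed
    ultimately have "t * (g \<bullet> u) \<le> t * (h q - h p + e)" by (simp add: algebra_simps)
    then show ?thesis using t by simp
  qed
  then show ?thesis unfolding u_def[symmetric] by (rule field_le_epsilon)
qed

lemma has_gradient_uminus:
  assumes "has_gradient h g p"
  shows "has_gradient (\<lambda>u. - h u) (- g) p"
proof -
  have g: "g \<in> carrier_vec (dim_vec p)" using assms by (simp add: has_gradient_def)
  have "\<bar>- h (p + u) - - h p - - g \<bullet> u\<bar> = \<bar>h (p + u) - h p - g \<bullet> u\<bar>"
    if "u \<in> carrier_vec (dim_vec p)" for u
    using g that scalar_prod_uminus_left[of g u] by simp
  then show ?thesis using assms by (simp add: has_gradient_def)
qed

text \<open>Multiplication by diag(I, -I). It turns the gradient of the joint function into the
  saddle field and the Hessian into its Jacobian; being an isometry, it preserves the Lipschitz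
  constant.\<close>

definition flip_tail :: "nat \<Rightarrow> real vec \<Rightarrow> real vec" where
  "flip_tail k g = vec (dim_vec g) (\<lambda>i. if i < k then g $ i else - g $ i)"

definition flip_tail_mat :: "nat \<Rightarrow> real mat \<Rightarrow> real mat" where
  "flip_tail_mat k A = mat (dim_row A) (dim_col A) (\<lambda>(i, j). if i < k then A $$ (i, j) else - A $$ (i, j))"

lemma flip_tail_carrier [simp]: "flip_tail k g \<in> carrier_vec n \<longleftrightarrow> g \<in> carrier_vec n"
  unfolding flip_tail_def carrier_vec_def by simp

lemma vnorm_flip_tail [simp]: "vnorm (flip_tail k g) = vnorm g"
proof -
  have "flip_tail k g \<bullet> flip_tail k g = g \<bullet> g"
    unfolding scalar_prod_def by (intro sum.cong) (auto simp: flip_tail_def)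
  then show ?thesis by (simp add: vnorm_def)
qed

lemma flip_tail_minus:
  "a \<in> carrier_vec n \<Longrightarrow> b \<in> carrier_vec n \<Longrightarrow> flip_tail k a - flip_tail k b = flip_tail k (a - b)"
  by (intro eq_vecI) (auto simp: flip_tail_def)

lemma flip_tail_mat_carrier [simp]: "flip_tail_mat k A \<in> carrier_mat r c \<longleftrightarrow> A \<in> carrier_mat r c"
  unfolding flip_tail_mat_def carrier_mat_def by simp

lemma flip_tail_mult_mat_vec:
  assumes "A \<in> carrier_mat r n" "v \<in> carrier_vec n"
  shows "flip_tail_mat k A *\<^sub>v v = flip_tail k (A *\<^sub>v v)"
  using assms
  by (intro eq_vecI) (auto simp: flip_tail_mat_def flip_tail_def scalar_prod_def sum_negf)

lemma flip_tail_append: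
  assumes "g \<in> carrier_vec (k + l)"
  shows "flip_tail k g = vec_first g k @\<^sub>v - vec_last g l"
  using assms by (intro eq_vecI) (auto simp: flip_tail_def vec_first_def vec_last_def)

section \<open>The saddle field as a monotone field\<close>

locale smooth_saddle =
  fixes dx dy :: nat and f :: "real vec \<Rightarrow> real vec \<Rightarrow> real" and \<rho> :: real and xs ys :: "real vec"
  assumes smooth: "twice_cont_diff (dx + dy) (joint dx dy f)"
    and lip: "lipschitz_hessian (dx + dy) \<rho> (joint dx dy f)"
    and conv: "y \<in> carrier_vec dy \<Longrightarrow> convex_fun dx (\<lambda>x. f x y)"
    and conc: "x \<in> carrier_vec dx \<Longrightarrow> concave_fun dy (\<lambda>y. f x y)"
    and saddle: "is_saddle dx dy f xs ys"
    and rho_pos: "\<rho> > 0"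
begin

abbreviation "n \<equiv> dx + dy"
abbreviation "G \<equiv> gradient (joint dx dy f)"
abbreviation "F \<equiv> saddle_field dx dy f"
abbreviation "H \<equiv> hessian (joint dx dy f)"

lemma G_gradient: "z \<in> carrier_vec n \<Longrightarrow> has_gradient (joint dx dy f) (G z) z"
  using smooth gradient_eq unfolding twice_cont_diff_def by metis

lemma G_carrier: "z \<in> carrier_vec n \<Longrightarrow> G z \<in> carrier_vec n"
  using G_gradient[of z] by (auto simp: has_gradient_def)

lemma H_jacobian:
  assumes z: "z \<in> carrier_vec n"
  shows "has_jacobian G (H z) z"
proof -
  obtain A where A: "has_jacobian G A z"
    using smooth z unfolding twice_cont_diff_def by blast
  have "H z = A" unfolding hessian_def by (rule jacobian_eq[OF G_carrier z A])
  then show ?thesis using A by simp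
qed

lemma H_carrier: "z \<in> carrier_vec n \<Longrightarrow> H z \<in> carrier_mat n n"
  using H_jacobian[of z] G_carrier[of z] by (auto simp: has_jacobian_def)

lemma xs_carrier: "xs \<in> carrier_vec dx" and ys_carrier: "ys \<in> carrier_vec dy"
  using saddle by (auto simp: is_saddle_def)

text \<open>Smoothness is assumed of the joint function, while the saddle field is built from the
  two partial gradients. Perturbations of one block, padded by zeros in the other, connect
  them.\<close>

lemma partial_gradients:
  assumes x: "x \<in> carrier_vec dx" and y: "y \<in> carrier_vec dy"
  shows "has_gradient (\<lambda>u. f u y) (vec_first (G (x @\<^sub>v y)) dx) x"
    and "has_gradient (\<lambda>v. f x v) (vec_last (G (x @\<^sub>v y)) dy) y"
proof -
  have z: "x @\<^sub>v y \<in> carrier_vec n" using x y by simp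
  define g where "g = G (x @\<^sub>v y)"
  have g: "g \<in> carrier_vec n" using G_carrier[OF z] by (simp add: g_def)
  have dims: "dim_vec x = dx" "dim_vec y = dy" "dim_vec (x @\<^sub>v y) = n" using x y by auto
  have jt: "joint dx dy f (a @\<^sub>v b) = f a b" if "a \<in> carrier_vec dx" "b \<in> carrier_vec dy" for a b
    using that by (simp add: joint_def vec_first_append vec_last_append)
  have split: "g \<bullet> (a @\<^sub>v b) = vec_first g dx \<bullet> a + vec_last g dy \<bullet> b"
    if "a \<in> carrier_vec dx" "b \<in> carrier_vec dy" for a b
    using scalar_prod_append[of "vec_first g dx" dx "vec_last g dy" dy a b] that g by simp
  have nrm: "vnorm (u @\<^sub>v 0\<^sub>v dy) = vnorm u" "vnorm (0\<^sub>v dx @\<^sub>v w) = vnorm w"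
    if "u \<in> carrier_vec dx" "w \<in> carrier_vec dy" for u w
    using vnorm_append[OF that(1) zero_carrier_vec] vnorm_append[OF zero_carrier_vec that(2)] by simp_all
  have ad: "(x @\<^sub>v y) + (u @\<^sub>v w) = (x + u) @\<^sub>v (y + w)"
    if "u \<in> carrier_vec dx" "w \<in> carrier_vec dy" for u w
    using append_vec_add[OF x that(1) y that(2)] by simp
  have *: "\<exists>\<delta>>0. \<forall>u\<in>carrier_vec n. vnorm u < \<delta> \<longrightarrow>
      \<bar>joint dx dy f ((x @\<^sub>v y) + u) - joint dx dy f (x @\<^sub>v y) - g \<bullet> u\<bar> \<le> e * vnorm u" if "e > 0" for e
    using G_gradient[OF z] that by (simp add: has_gradient_def dims g_def)
  show "has_gradient (\<lambda>u. f u y) (vec_first (G (x @\<^sub>v y)) dx) x"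
    unfolding has_gradient_def dims g_def[symmetric]
  proof (intro conjI allI impI)
    fix e :: real assume "e > 0"
    from *[OF this] obtain \<delta> where d: "\<delta> > 0" "\<And>u. u \<in> carrier_vec n \<Longrightarrow> vnorm u < \<delta> \<Longrightarrow>
      \<bar>joint dx dy f ((x @\<^sub>v y) + u) - joint dx dy f (x @\<^sub>v y) - g \<bullet> u\<bar> \<le> e * vnorm u" by blast
    show "\<exists>\<delta>>0. \<forall>u\<in>carrier_vec dx. vnorm u < \<delta> \<longrightarrow>
        \<bar>f (x + u) y - f x y - vec_first g dx \<bullet> u\<bar> \<le> e * vnorm u"
    proof (intro exI[of _ \<delta>] conjI ballI impI d(1))
      fix u :: "real vec" assume u: "u \<in> carrier_vec dx" "vnorm u < \<delta>"
      have "y + 0\<^sub>v dy = y" using y by simp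
      then show "\<bar>f (x + u) y - f x y - vec_first g dx \<bullet> u\<bar> \<le> e * vnorm u"
        using d(2)[of "u @\<^sub>v 0\<^sub>v dy"] u x y
        by (simp add: nrm ad jt split)
    qed
  qed simp
  show "has_gradient (\<lambda>v. f x v) (vec_last (G (x @\<^sub>v y)) dy) y"
    unfolding has_gradient_def dims g_def[symmetric]
  proof (intro conjI allI impI)
    fix e :: real assume "e > 0"
    from *[OF this] obtain \<delta> where d: "\<delta> > 0" "\<And>u. u \<in> carrier_vec n \<Longrightarrow> vnorm u < \<delta> \<Longrightarrow>
      \<bar>joint dx dy f ((x @\<^sub>v y) + u) - joint dx dy f (x @\<^sub>v y) - g \<bullet> u\<bar> \<le> e * vnorm u" by blast
    show "\<exists>\<delta>>0. \<forall>u\<in>carrier_vec dy. vnorm u < \<delta> \<longrightarrow>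
        \<bar>f x (y + u) - f x y - vec_last g dy \<bullet> u\<bar> \<le> e * vnorm u"
    proof (intro exI[of _ \<delta>] conjI ballI impI d(1))
      fix u :: "real vec" assume u: "u \<in> carrier_vec dy" "vnorm u < \<delta>"
      have "x + 0\<^sub>v dx = x" using x by simp
      then show "\<bar>f x (y + u) - f x y - vec_last g dy \<bullet> u\<bar> \<le> e * vnorm u"
        using d(2)[of "0\<^sub>v dx @\<^sub>v u"] u x y
        by (simp add: nrm ad jt split)
    qed
  qed simp
qed

lemma saddle_field_append:
  assumes "x \<in> carrier_vec dx" "y \<in> carrier_vec dy"
  shows "F (x @\<^sub>v y) = vec_first (G (x @\<^sub>v y)) dx @\<^sub>v - vec_last (G (x @\<^sub>v y)) dy"
  unfolding saddle_field_def Let_def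
  by (simp add: vec_first_append[OF assms] vec_last_append[OF assms]
      gradient_eq[OF partial_gradients(1)[OF assms]] gradient_eq[OF partial_gradients(2)[OF assms]])

lemma saddle_field_eq:
  assumes z: "z \<in> carrier_vec n"
  shows "F z = flip_tail dx (G z)"
proof -
  have "F z = F (vec_first z dx @\<^sub>v vec_last z dy)" using z by simp
  also have "\<dots> = vec_first (G z) dx @\<^sub>v - vec_last (G z) dy"
    using saddle_field_append[of "vec_first z dx" "vec_last z dy"] z by simp
  finally show ?thesis using flip_tail_append[OF G_carrier[OF z]] by simp
qed

lemma saddle_field_carrier: "z \<in> carrier_vec n \<Longrightarrow> F z \<in> carrier_vec n"
  by (simp add: saddle_field_eq G_carrier)

lemma saddle_field_has_jacobian:
  assumes z: "z \<in> carrier_vec n"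
  shows "has_jacobian F (flip_tail_mat dx (H z)) z"
proof -
  have dims: "dim_vec z = n" "dim_vec (F z) = n" "dim_vec (G z) = n"
    using z saddle_field_carrier[OF z] G_carrier[OF z] by auto
  have "F (z + u) - F z - flip_tail_mat dx (H z) *\<^sub>v u = flip_tail dx (G (z + u) - G z - H z *\<^sub>v u)"
    if u: "u \<in> carrier_vec n" for u
  proof -
    have c: "G (z + u) \<in> carrier_vec n" "G z \<in> carrier_vec n" "H z *\<^sub>v u \<in> carrier_vec n"
      using z u G_carrier H_carrier by (auto intro!: mult_mat_vec_carrier)
    show ?thesis
      using z u flip_tail_minus[OF c(1,2), of dx] flip_tail_minus[OF minus_carrier_vec[OF c(1,2)] c(3), of dx]
      by (simp add: saddle_field_eq flip_tail_mult_mat_vec[OF H_carrier[OF z] u])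
  qed
  then show ?thesis
    using H_jacobian[OF z] H_carrier[OF z] by (simp add: has_jacobian_def dims)
qed

lemma saddle_field_jacobian_eq:
  "z \<in> carrier_vec n \<Longrightarrow> jacobian F z = flip_tail_mat dx (H z)"
  by (rule jacobian_eq[OF saddle_field_carrier _ saddle_field_has_jacobian])

text \<open>The sum of two gradient inequalities, convexity in x and concavity in y, in which the
  value of f at z cancels. Monotonicity, the inequality at the saddle point and the gap estimate all
  come from here.\<close>

lemma saddle_field_gap_le:
  assumes z: "z \<in> carrier_vec n" and x: "x \<in> carrier_vec dx" and y: "y \<in> carrier_vec dy"
  shows "f (vec_first z dx) y - f x (vec_last z dy) \<le> F z \<bullet> (z - (x @\<^sub>v y))"
proof -
  define x' y' where "x' = vec_first z dx" and "y' = vec_last z dy"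
  have c: "x' \<in> carrier_vec dx" "y' \<in> carrier_vec dy" and zz: "z = x' @\<^sub>v y'"
    using z by (auto simp: x'_def y'_def)
  define gx gy where "gx = vec_first (G z) dx" and "gy = vec_last (G z) dy"
  have g: "gx \<in> carrier_vec dx" "gy \<in> carrier_vec dy" by (auto simp: gx_def gy_def)
  have "gx \<bullet> (x - x') \<le> f x y' - f x' y'"
    using convex_gradient_le[OF conv[OF c(2)] partial_gradients(1)[OF c] c(1) x] by (simp add: gx_def zz)
  moreover have "gx \<bullet> (x - x') = - (gx \<bullet> (x' - x))"
    using scalar_prod_minus_distrib[OF g(1) x c(1)] scalar_prod_minus_distrib[OF g(1) c(1) x] by simp
  moreover have "- gy \<bullet> (y - y') \<le> - f x' y - - f x' y'"
    using convex_gradient_le[OF conc[OF c(1), unfolded concave_fun_def]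
        has_gradient_uminus[OF partial_gradients(2)[OF c]] c(2) y] by (simp add: gy_def zz)
  moreover have "- gy \<bullet> (y - y') = - (- gy \<bullet> (y' - y))"
    using scalar_prod_minus_distrib[of "- gy" dy, OF _ y c(2)] scalar_prod_minus_distrib[of "- gy" dy, OF _ c(2) y] g
    by simp
  moreover have "F z \<bullet> (z - (x @\<^sub>v y)) = gx \<bullet> (x' - x) + - gy \<bullet> (y' - y)"
  proof -
    have "F z = gx @\<^sub>v - gy" using saddle_field_append[OF c] by (simp add: zz gx_def gy_def)
    moreover have "z - (x @\<^sub>v y) = (x' - x) @\<^sub>v (y' - y)"
      unfolding zz by (rule append_vec_minus[OF c(1) x c(2) y])
    ultimately show ?thesis
      using scalar_prod_append[of gx dx "- gy" dy "x' - x" "y' - y"] g c x y by (simp add: minus_carrier_vec)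
  qed
  ultimately show ?thesis by (simp add: x'_def y'_def)
qed

text \<open>The gap estimate is used for (z, w) and for (w, z); the left sides are opposite
  numbers.\<close>

lemma saddle_field_monotone:
  assumes z: "z \<in> carrier_vec n" and w: "w \<in> carrier_vec n"
  shows "0 \<le> (F z - F w) \<bullet> (z - w)"
proof -
  have "0 \<le> F z \<bullet> (z - w) + F w \<bullet> (w - z)"
    using saddle_field_gap_le[OF z vec_first_carrier vec_last_carrier, of w w]
      saddle_field_gap_le[OF w vec_first_carrier vec_last_carrier, of z z] z w by simp
  also have "F w \<bullet> (w - z) = - (F w \<bullet> (z - w))"
    using scalar_prod_minus_distrib[OF saddle_field_carrier[OF w] z w]
      scalar_prod_minus_distrib[OF saddle_field_carrier[OF w] w z] by simp
  finally show ?thesis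
    using minus_scalar_prod_distrib[OF saddle_field_carrier[OF z] saddle_field_carrier[OF w] minus_carrier_vec[OF z w]]
    by simp
qed

lemma saddle_field_minty:
  assumes z: "z \<in> carrier_vec n"
  shows "0 \<le> F z \<bullet> (z - (xs @\<^sub>v ys))"
proof -
  have "f xs (vec_last z dy) \<le> f xs ys" "f xs ys \<le> f (vec_first z dx) ys"
    using saddle by (auto simp: is_saddle_def)
  then show ?thesis using saddle_field_gap_le[OF z xs_carrier ys_carrier] by simp
qed

lemma saddle_field_line_derivative:
  assumes "z \<in> carrier_vec n" "u \<in> carrier_vec n" "v \<in> carrier_vec n"
  shows "((\<lambda>t. v \<bullet> F (z + t \<cdot>\<^sub>v u)) has_real_derivative v \<bullet> (jacobian F z *\<^sub>v u)) (at 0)"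
proof -
  have "0 \<cdot>\<^sub>v u = 0\<^sub>v n" using assms by (auto intro!: eq_vecI)
  then have "has_jacobian F (jacobian F z) (z + 0 \<cdot>\<^sub>v u)"
    using saddle_field_has_jacobian[OF assms(1)] saddle_field_jacobian_eq[OF assms(1)] assms by simp
  then show ?thesis
    by (rule has_jacobian_along_line[where G = F and n = n and k = n, rotated -1])
      (use assms saddle_field_carrier in auto)
qed

text \<open>Passage from the Minty inequality to a zero by continuity. If r = F zs were nonzero, F
  would still pair positively with r at zs + t r for small t < 0, while the inequality there says
  that t times this pairing is nonnegative.\<close>

lemma saddle_field_zero: "F (xs @\<^sub>v ys) = 0\<^sub>v n"
proof -
  define zs where "zs = xs @\<^sub>v ys"
  have zs: "zs \<in> carrier_vec n" using xs_carrier ys_carrier by (simp add: zs_def)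
  define r where "r = F zs"
  have r: "r \<in> carrier_vec n" using saddle_field_carrier[OF zs] by (simp add: r_def)
  define h where "h = (\<lambda>t. r \<bullet> F (zs + t \<cdot>\<^sub>v r))"
  have "isCont h 0"
    unfolding h_def by (rule DERIV_isCont[OF saddle_field_line_derivative[OF zs r r]])
  then have lim: "(h \<longlongrightarrow> h 0) (at 0)" by (simp add: isCont_def)
  have "0 \<cdot>\<^sub>v r = 0\<^sub>v n" using r by (auto intro!: eq_vecI)
  then have h0: "h 0 = (vnorm r)\<^sup>2" using zs by (simp add: h_def r_def vnorm_power2)
  have "\<not> h 0 > 0"
  proof
    assume "h 0 > 0"
    then have "eventually (\<lambda>t. h t > 0) (at 0)" using order_tendstoD(1)[OF lim] by simp
    then obtain d where d: "d > 0" "\<And>t. t \<noteq> 0 \<Longrightarrow> \<bar>t\<bar> < d \<Longrightarrow> h t > 0"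
      by (auto simp: eventually_at)
    define t where "t = - (d / 2)"
    have t: "t < 0" "h t > 0" using d(1) d(2)[of t] by (auto simp: t_def)
    have c: "F (zs + t \<cdot>\<^sub>v r) \<in> carrier_vec n" using zs r by (intro saddle_field_carrier) simp
    have "zs + t \<cdot>\<^sub>v r - zs = t \<cdot>\<^sub>v r" using zs r by (intro eq_vecI) auto
    then have "0 \<le> F (zs + t \<cdot>\<^sub>v r) \<bullet> (t \<cdot>\<^sub>v r)"
      using saddle_field_minty[of "zs + t \<cdot>\<^sub>v r"] zs r by (simp add: zs_def[symmetric])
    also have "\<dots> = t * h t" using c r comm_scalar_prod[OF c r] by (simp add: h_def)
    finally show False using t mult_neg_pos[of t "h t"] by linarith
  qed
  then have "vnorm r = 0" using h0 by simp
  then show ?thesis using vnorm_eq_0[OF r] by (simp add: r_def zs_def)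
qed

text \<open>Infinitesimal monotonicity: a negative derivative of the pairing of u with F along u
  would make it decrease just to the right of 0.\<close>

lemma saddle_field_jacobian_monotone:
  assumes z: "z \<in> carrier_vec n"
  shows "monotone_mat n (jacobian F z)"
  unfolding monotone_mat_def
proof (intro conjI ballI)
  show J: "jacobian F z \<in> carrier_mat n n"
    using z H_carrier[OF z] by (simp add: saddle_field_jacobian_eq)
  fix u :: "real vec" assume u: "u \<in> carrier_vec n"
  define h where "h = (\<lambda>t. u \<bullet> F (z + t \<cdot>\<^sub>v u))"
  have der: "(h has_real_derivative u \<bullet> (jacobian F z *\<^sub>v u)) (at 0)"
    unfolding h_def by (rule saddle_field_line_derivative[OF z u u])
  show "0 \<le> u \<bullet> (jacobian F z *\<^sub>v u)"
  proof (rule ccontr)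
    assume "\<not> 0 \<le> u \<bullet> (jacobian F z *\<^sub>v u)"
    then obtain d where d: "d > 0" "\<And>t. 0 < t \<Longrightarrow> t < d \<Longrightarrow> h (0 + t) < h 0"
      using DERIV_neg_dec_right[OF der] by auto
    define t where "t = d / 2"
    have t: "t > 0" "h t < h 0" using d(1) d(2)[of t] by (auto simp: t_def)
    have zt: "z + t \<cdot>\<^sub>v u \<in> carrier_vec n" using z u by simp
    have "0 \<cdot>\<^sub>v u = 0\<^sub>v n" using u by (auto intro!: eq_vecI)
    then have h0: "h 0 = u \<bullet> F z" using z by (simp add: h_def)
    have "z + t \<cdot>\<^sub>v u - z = t \<cdot>\<^sub>v u" using z u by (intro eq_vecI) auto
    then have "0 \<le> (F (z + t \<cdot>\<^sub>v u) - F z) \<bullet> (t \<cdot>\<^sub>v u)"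
      using saddle_field_monotone[OF zt z] by simp
    also have "\<dots> = t * (h t - h 0)"
      using minus_scalar_prod_distrib[OF saddle_field_carrier[OF zt] saddle_field_carrier[OF z] u]
        comm_scalar_prod[OF saddle_field_carrier[OF zt] u] comm_scalar_prod[OF saddle_field_carrier[OF z] u]
        saddle_field_carrier[OF zt] saddle_field_carrier[OF z] u
      by (simp add: h0 minus_carrier_vec) (simp add: h_def)
    finally show False using t mult_pos_neg[of t "h t - h 0"] by linarith
  qed
qed

lemma saddle_field_jacobian_lipschitz:
  assumes p: "p \<in> carrier_vec n" and q: "q \<in> carrier_vec n" and u: "u \<in> carrier_vec n"
  shows "vnorm (jacobian F p *\<^sub>v u - jacobian F q *\<^sub>v u) \<le> \<rho> * vnorm (p - q) * vnorm u"
proof -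
  have c: "H p *\<^sub>v u \<in> carrier_vec n" "H q *\<^sub>v u \<in> carrier_vec n"
    using H_carrier p q u by (auto intro!: mult_mat_vec_carrier)
  have "jacobian F p *\<^sub>v u - jacobian F q *\<^sub>v u = flip_tail dx (H p *\<^sub>v u - H q *\<^sub>v u)"
    using p q u H_carrier c by (simp add: saddle_field_jacobian_eq flip_tail_mult_mat_vec[of _ n n] flip_tail_minus[of _ n])
  also have "H p *\<^sub>v u - H q *\<^sub>v u = (H p - H q) *\<^sub>v u"
    using minus_mult_distrib_mat_vec[OF H_carrier[OF p] H_carrier[OF q] u] by simp
  finally have "vnorm (jacobian F p *\<^sub>v u - jacobian F q *\<^sub>v u) \<le> specnorm (H p - H q) * vnorm u"
    using vnorm_mult_mat_vec_le[of "H p - H q" n n u] H_carrier p q u by (simp add: minus_carrier_mat)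
  also have "\<dots> \<le> \<rho> * vnorm (p - q) * vnorm u"
    using lip p q by (intro mult_right_mono) (auto simp: lipschitz_hessian_def)
  finally show ?thesis .
qed

sublocale monotone_field n F "jacobian F" \<rho> "xs @\<^sub>v ys"
proof
  show "has_jacobian F (jacobian F z) z" if "z \<in> carrier_vec n" for z
    using saddle_field_has_jacobian[OF that] by (simp add: saddle_field_jacobian_eq[OF that])
qed (use saddle_field_carrier saddle_field_jacobian_monotone saddle_field_jacobian_lipschitz rho_pos
      xs_carrier ys_carrier saddle_field_zero saddle_field_minty in auto)

end

section \<open>The averaged iterate of LEN\<close>

text \<open>Jensen's inequality in the accumulator form in which LEN builds its output. A new term
  mixes the old average, with share s = W / (W + c T), and the new point.\<close>

lemma convex_weighted_average:
  fixes c :: "nat \<Rightarrow> real" and p ws :: "nat \<Rightarrow> real vec"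
  assumes c: "\<And>t. c t > 0" and p: "\<And>t. p t \<in> carrier_vec n"
    and ws0: "ws 0 = 0\<^sub>v n" and wsS: "\<And>t. ws (Suc t) = ws t + c t \<cdot>\<^sub>v p t"
    and conv: "convex_fun n \<Phi>" and T: "T \<ge> 1"
  shows "(\<Sum>t<T. c t) * \<Phi> ((1 / (\<Sum>t<T. c t)) \<cdot>\<^sub>v ws T) \<le> (\<Sum>t<T. c t * \<Phi> (p t))"
proof -
  have ws: "ws t \<in> carrier_vec n" for t
    by (induction t) (auto simp: ws0 wsS p)
  show ?thesis using T
  proof (induction T rule: nat_induct_at_least)
    case base
    have "(1 / c 0) \<cdot>\<^sub>v ws 1 = p 0"
      using c[of 0] p[of 0] by (auto simp: wsS ws0 intro!: eq_vecI)
    then show ?case using c[of 0] by simp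
  next
    case (Suc T)
    define W where "W = (\<Sum>t<T. c t)"
    have W: "W > 0" unfolding W_def using Suc.hyps c by (intro sum_pos) (auto simp: lessThan_empty_iff)
    have Wc: "W + c T > 0" using W c[of T] by simp
    define s where "s = W / (W + c T)"
    have s: "0 \<le> s" "s \<le> 1" "1 - s = c T / (W + c T)" using W c[of T] by (auto simp: s_def field_simps)
    define q where "q = (1 / W) \<cdot>\<^sub>v ws T"
    have q: "q \<in> carrier_vec n" using ws by (simp add: q_def)
    have "(1 / (W + c T)) \<cdot>\<^sub>v ws (Suc T) = s \<cdot>\<^sub>v q + (1 - s) \<cdot>\<^sub>v p T"
    proof (rule eq_vecI)
      fix i assume "i < dim_vec (s \<cdot>\<^sub>v q + (1 - s) \<cdot>\<^sub>v p T)"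
      then have i: "i < n" using p[of T] by simp
      have "s * (1 / W) = 1 / (W + c T)" using W Wc by (simp add: s_def)
      then have "s * (1 / W * ws T $ i) = 1 / (W + c T) * ws T $ i" by (simp only: mult.assoc[symmetric])
      then show "((1 / (W + c T)) \<cdot>\<^sub>v ws (Suc T)) $ i = (s \<cdot>\<^sub>v q + (1 - s) \<cdot>\<^sub>v p T) $ i"
        using i carrier_vecD[OF ws[of T]] carrier_vecD[OF p[of T]] carrier_vecD[OF q]
        unfolding s(3) wsS by (simp add: q_def distrib_left)
    qed (use carrier_vecD[OF ws[of T]] carrier_vecD[OF p[of T]] carrier_vecD[OF q] in \<open>auto simp: wsS\<close>)
    moreover have "\<Phi> (s \<cdot>\<^sub>v q + (1 - s) \<cdot>\<^sub>v p T) \<le> s * \<Phi> q + (1 - s) * \<Phi> (p T)"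
      using conv q p s(1,2) unfolding convex_fun_def by blast
    ultimately have "\<Phi> ((1 / (W + c T)) \<cdot>\<^sub>v ws (Suc T)) \<le> s * \<Phi> q + (1 - s) * \<Phi> (p T)"
      by (simp only:)
    then have "(W + c T) * \<Phi> ((1 / (W + c T)) \<cdot>\<^sub>v ws (Suc T)) \<le> (W + c T) * (s * \<Phi> q + (1 - s) * \<Phi> (p T))"
      using Wc by (intro mult_left_mono) auto
    also have "\<dots> = W * \<Phi> q + c T * \<Phi> (p T)"
    proof -
      have "(W + c T) * s = W" "(W + c T) * (1 - s) = c T"
        unfolding s(3) using Wc by (simp_all add: s_def)
      then show ?thesis by (simp only: distrib_left mult.assoc[symmetric])
    qed
    also have "W * \<Phi> q \<le> (\<Sum>t<T. c t * \<Phi> (p t))" using Suc.IH by (simp add: W_def q_def)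
    finally show ?case by (simp add: W_def)
  qed
qed

text \<open>The tangent of \<open>1 / sqrt u\<close> at \<open>u = lam\<^sup>2\<close>, which replaces Hoelder's inequality.\<close>

lemma inverse_ge_tangent:
  fixes \<gamma> lam :: real
  assumes "\<gamma> > 0" "lam > 0"
  shows "1 / \<gamma> \<ge> 3 / (2 * lam) - \<gamma>\<^sup>2 / (2 * lam ^ 3)"
proof -
  have "0 \<le> (lam - \<gamma>)\<^sup>2 * (2 * lam + \<gamma>)" using assms by simp
  also have "\<dots> = 2 * lam ^ 3 - \<gamma> * (3 * lam\<^sup>2 - \<gamma>\<^sup>2)"
    by (simp add: power2_eq_square power3_eq_cube algebra_simps)
  finally have "\<gamma> * (3 * lam\<^sup>2 - \<gamma>\<^sup>2) \<le> 2 * lam ^ 3" by simp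
  then have "(3 * lam\<^sup>2 - \<gamma>\<^sup>2) / (2 * lam ^ 3) \<le> 1 / \<gamma>"
    using assms by (simp add: field_simps)
  moreover have "(3 * lam\<^sup>2 - \<gamma>\<^sup>2) / (2 * lam ^ 3) = 3 / (2 * lam) - \<gamma>\<^sup>2 / (2 * lam ^ 3)"
    using assms by (simp add: diff_divide_distrib power2_eq_square power3_eq_cube)
  ultimately show ?thesis by simp
qed

text \<open>One weight of size at most 2 tol contributes B by itself. Otherwise the weights are
  square summable with a known bound, and the tangent inequality is summed.\<close>

lemma weight_sum_ge:
  fixes \<gamma> a :: "nat \<Rightarrow> real"
  assumes \<gamma>: "\<And>t. \<gamma> t > 0" and B: "B > 0" and T: "T \<ge> 1"
    and dich: "\<And>t. \<gamma> t \<le> 2 * tol \<or> \<gamma> t \<le> K * a t"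
    and tol: "2 * tol * B \<le> 1"
    and a: "(\<Sum>t<T. (a t)\<^sup>2) \<le> A"
    and big: "B\<^sup>2 * (K\<^sup>2 * A) \<le> real T ^ 3"
  shows "B \<le> (\<Sum>t<T. 1 / \<gamma> t)"
proof (cases "\<exists>t<T. \<gamma> t \<le> 2 * tol")
  case True
  then obtain t where t: "t < T" "\<gamma> t \<le> 2 * tol" by blast
  have "B * \<gamma> t \<le> B * (2 * tol)" using t B by (intro mult_left_mono) auto
  then have "B \<le> 1 / \<gamma> t" using tol \<gamma>[of t] by (simp add: field_simps)
  also have "\<dots> \<le> (\<Sum>t<T. 1 / \<gamma> t)"
    using t \<gamma> by (intro member_le_sum) (auto simp: less_imp_le)
  finally show ?thesis .
next
  case False
  \<comment> \<open>T equal weights of this size would have inverses summing to exactly B;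
    \<open>big\<close> says that the sum of squares is at most T lam^2.\<close>
  define lam where "lam = real T / B"
  have lam: "lam > 0" using T B by (simp add: lam_def)
  have "(\<Sum>t<T. (\<gamma> t)\<^sup>2) \<le> (\<Sum>t<T. K\<^sup>2 * (a t)\<^sup>2)"
  proof (intro sum_mono)
    fix t assume "t \<in> {..<T}"
    then have "\<gamma> t \<le> K * a t" using False dich by auto
    then have "(\<gamma> t)\<^sup>2 \<le> (K * a t)\<^sup>2" using \<gamma>[of t] by (intro power_mono) auto
    then show "(\<gamma> t)\<^sup>2 \<le> K\<^sup>2 * (a t)\<^sup>2" by (simp add: power_mult_distrib)
  qed
  also have "\<dots> \<le> K\<^sup>2 * A" using a by (simp add: sum_distrib_left[symmetric] mult_left_mono)
  finally have G: "(\<Sum>t<T. (\<gamma> t)\<^sup>2) \<le> K\<^sup>2 * A" .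
  have "K\<^sup>2 * A \<le> real T * lam\<^sup>2"
    using big B by (simp add: lam_def power_divide field_simps power2_eq_square power3_eq_cube)
  with G have "(\<Sum>t<T. (\<gamma> t)\<^sup>2) \<le> real T * lam\<^sup>2" by simp
  then have "(\<Sum>t<T. (\<gamma> t)\<^sup>2) / (2 * lam ^ 3) \<le> real T * lam\<^sup>2 / (2 * lam ^ 3)"
    using lam by (intro divide_right_mono) auto
  also have "\<dots> = real T / (2 * lam)" using lam by (simp add: power2_eq_square power3_eq_cube)
  finally have "B \<le> 3 * real T / (2 * lam) - (\<Sum>t<T. (\<gamma> t)\<^sup>2) / (2 * lam ^ 3)"
    using T B by (simp add: lam_def field_simps)
  also have "\<dots> = (\<Sum>t<T. 3 / (2 * lam) - (\<gamma> t)\<^sup>2 / (2 * lam ^ 3))"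
    by (simp add: sum_subtractf sum_divide_distrib)
  also have "\<dots> \<le> (\<Sum>t<T. 1 / \<gamma> t)"
    using inverse_ge_tangent[OF \<gamma> lam] by (intro sum_mono) auto
  finally show ?thesis .
qed

lemma convex_fun_vnorm_diff:
  assumes c: "c \<in> carrier_vec n"
  shows "convex_fun n (\<lambda>z. vnorm (z - c))"
  unfolding convex_fun_def
proof (intro ballI allI impI)
  fix p q :: "real vec" and s :: real
  assume p: "p \<in> carrier_vec n" and q: "q \<in> carrier_vec n" and s: "0 \<le> s \<and> s \<le> 1"
  have "s \<cdot>\<^sub>v p + (1 - s) \<cdot>\<^sub>v q - c = s \<cdot>\<^sub>v (p - c) + (1 - s) \<cdot>\<^sub>v (q - c)"
    using p q c by (intro eq_vecI) (auto simp: algebra_simps)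
  then show "vnorm (s \<cdot>\<^sub>v p + (1 - s) \<cdot>\<^sub>v q - c) \<le> s * vnorm (p - c) + (1 - s) * vnorm (q - c)"
    using vnorm_add_le[of "s \<cdot>\<^sub>v (p - c)" n "(1 - s) \<cdot>\<^sub>v (q - c)"] p q c s
    by (simp add: vnorm_smult minus_carrier_vec)
qed

lemma vec_first_combination:
  fixes p q :: "real vec"
  assumes "p \<in> carrier_vec (k + l)" "q \<in> carrier_vec (k + l)"
  shows "vec_first (s \<cdot>\<^sub>v p + t \<cdot>\<^sub>v q) k = s \<cdot>\<^sub>v vec_first p k + t \<cdot>\<^sub>v vec_first q k"
    "vec_last (s \<cdot>\<^sub>v p + t \<cdot>\<^sub>v q) l = s \<cdot>\<^sub>v vec_last p l + t \<cdot>\<^sub>v vec_last q l"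
  using assms by (auto intro!: eq_vecI simp: vec_first_def vec_last_def)

context smooth_saddle
begin

lemma convex_fun_gap:
  assumes x: "x \<in> carrier_vec dx" and y: "y \<in> carrier_vec dy"
  shows "convex_fun n (\<lambda>z. f (vec_first z dx) y - f x (vec_last z dy))"
  unfolding convex_fun_def
proof (intro ballI allI impI)
  fix p q :: "real vec" and s :: real
  assume p: "p \<in> carrier_vec n" and q: "q \<in> carrier_vec n" and s: "0 \<le> s \<and> s \<le> 1"
  have "f (s \<cdot>\<^sub>v vec_first p dx + (1 - s) \<cdot>\<^sub>v vec_first q dx) y
      \<le> s * f (vec_first p dx) y + (1 - s) * f (vec_first q dx) y"
    using conv[OF y] s by (simp add: convex_fun_def)
  moreover have "- f x (s \<cdot>\<^sub>v vec_last p dy + (1 - s) \<cdot>\<^sub>v vec_last q dy)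
      \<le> s * - f x (vec_last p dy) + (1 - s) * - f x (vec_last q dy)"
    using conc[OF x, unfolded concave_fun_def convex_fun_def] s vec_last_carrier by blast
  ultimately show "f (vec_first (s \<cdot>\<^sub>v p + (1 - s) \<cdot>\<^sub>v q) dx) y - f x (vec_last (s \<cdot>\<^sub>v p + (1 - s) \<cdot>\<^sub>v q) dy)
      \<le> s * (f (vec_first p dx) y - f x (vec_last p dy)) + (1 - s) * (f (vec_first q dx) y - f x (vec_last q dy))"
    by (simp add: vec_first_combination[OF p q] algebra_simps)
qed

end

section \<open>One step of LEN unfolded, and its price\<close>

lemma
  fixes schur :: "real mat \<Rightarrow> complex mat \<times> complex mat"
  defines "QU \<equiv> \<lambda>t s F m. if t mod m = 0 then schur (jacobian F (iterate s)) else factors s"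
  defines "g \<equiv> \<lambda>p t s F m M \<Gamma> tol. fst (binary_search
      (\<lambda>\<gamma>. (M * vnorm (schur_solve (QU t s F m) \<gamma> (F (iterate s))) - \<gamma>, solve_price p + vecop p)) \<Gamma> tol)"
  shows len_step_factors: "factors (len_step p schur F m M \<Gamma> tol t s) = QU t s F m"
    and len_step_iterate: "iterate (len_step p schur F m M \<Gamma> tol t s) =
      iterate s - (1 / g p t s F m M \<Gamma> tol) \<cdot>\<^sub>v
        F (iterate s - schur_solve (QU t s F m) (g p t s F m M \<Gamma> tol) (F (iterate s)))"
    and len_step_weight_sum: "weight_sum (len_step p schur F m M \<Gamma> tol t s) =
      weight_sum s + 1 / g p t s F m M \<Gamma> tol"
    and len_step_weighted_sum: "weighted_sum (len_step p schur F m M \<Gamma> tol t s) =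
      weighted_sum s + (1 / g p t s F m M \<Gamma> tol) \<cdot>\<^sub>v
        (iterate s - schur_solve (QU t s F m) (g p t s F m M \<Gamma> tol) (F (iterate s)))"
  unfolding g_def QU_def len_step_def by (cases "t mod m = 0"; simp add: Let_def case_prod_unfold)+

text \<open>The number of halvings depends on \<Gamma> and tol alone, so the price is a closed
  formula. The extra 1 is the solve that produces the half step.\<close>

lemma len_step_spent:
  "spent (len_step p schur F m M \<Gamma> tol t s) = spent s
     + (if t mod m = 0 then eval_DF p + schur_dec p else 0)
     + (2 * eval_F p + (real (nat \<lceil>log 2 (\<Gamma> / tol)\<rceil>) + 1) * (solve_price p + vecop p) + 4 * vecop p)"
  unfolding len_step_def binary_search_def
  by (cases "t mod m = 0"; simp add: Let_def case_prod_unfold bisect_cost algebra_simps)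

text \<open>\<open>(t + m - 1) div m\<close> is t / m rounded up, the number of multiples of m below
  t, hence the number of snapshots taken.\<close>

lemma snapshot_count_Suc:
  fixes m t :: nat
  assumes "m \<ge> 1"
  shows "(Suc t + m - 1) div m = (t + m - 1) div m + (if t mod m = 0 then 1 else 0)"
proof -
  obtain k where k: "m = Suc k" using assms by (cases m) auto
  have "Suc (t + k) mod m = 0 \<longleftrightarrow> t mod m = 0"
  proof -
    have eq: "Suc (t + k) = t + m" by (simp add: k)
    show ?thesis unfolding eq by simp
  qed
  then show ?thesis using div_Suc[of "t + k" m] by (simp add: k)
qed

lemma len_run_spent:
  assumes "m \<ge> 1"
  shows "spent (len_run p schur F m M \<Gamma> tol z0 T) =
    real ((T + m - 1) div m) * (eval_DF p + schur_dec p)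
     + real T * (2 * eval_F p + (real (nat \<lceil>log 2 (\<Gamma> / tol)\<rceil>) + 1) * (solve_price p + vecop p) + 4 * vecop p)"
proof (induction T)
  case 0
  then show ?case using assms by simp
next
  case (Suc T)
  show ?case
    by (simp only: len_run.simps len_step_spent Suc.IH snapshot_count_Suc[OF assms])
      (simp add: algebra_simps)
qed

section \<open>The execution of LEN as a lazy extragradient run\<close>

context smooth_saddle
begin

text \<open>The bound 9 \<rho> \<beta> m makes \<open>phi\<close> nonpositive at \<Gamma> while the
  iterates stay in the ball; the added 1 keeps \<Gamma> positive when \<beta> = 0.\<close>

context
  fixes p :: prices and schur :: "real mat \<Rightarrow> complex mat \<times> complex mat"
    and m :: nat and \<Gamma> tol \<beta> :: real and z0 :: "real vec"
  assumes schur: "\<And>A. A \<in> carrier_mat n n \<Longrightarrow> is_schur n A (schur A)"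
    and m: "m \<ge> 1" and z0: "z0 \<in> carrier_vec n" and start: "vnorm (z0 - (xs @\<^sub>v ys)) \<le> \<beta>"
    and tol: "tol > 0" and \<Gamma>: "\<Gamma> \<ge> 9 * \<rho> * \<beta> * real m + 1"
begin

definition "st t = len_run p schur F m (3 * \<rho> * real m) \<Gamma> tol z0 t"
definition "zt t = iterate (st t)"
text \<open>The index is shifted because a step refreshes the factors before using them: those in
  force during step t are stored in the state after it.\<close>

definition "QU t = factors (st (Suc t))"
definition "phi t = (\<lambda>\<gamma>. (3 * \<rho> * real m * vnorm (schur_solve (QU t) \<gamma> (F (zt t))) - \<gamma>, solve_price p + vecop p))"
definition "gam t = fst (binary_search (phi t) \<Gamma> tol)"
definition "vt t = schur_solve (QU t) (gam t) (F (zt t))"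

lemma QU_step: "QU t = (if t mod m = 0 then schur (jacobian F (zt t)) else factors (st t))"
  by (simp add: QU_def st_def len_step_factors zt_def)

lemma zt_Suc: "zt (Suc t) = zt t - (1 / gam t) \<cdot>\<^sub>v F (zt t - vt t)"
  unfolding vt_def gam_def phi_def QU_step
  by (simp add: zt_def st_def len_step_iterate)

lemma weight_sum_eq: "weight_sum (st T) = (\<Sum>t<T. 1 / gam t)"
proof (induction T)
  case (Suc T)
  have "weight_sum (st (Suc T)) = weight_sum (st T) + 1 / gam T"
    unfolding gam_def phi_def QU_step by (simp add: zt_def st_def len_step_weight_sum)
  then show ?case using Suc by simp
qed (simp add: st_def)

lemma weighted_sum_Suc: "weighted_sum (st (Suc T)) = weighted_sum (st T) + (1 / gam T) \<cdot>\<^sub>v (zt T - vt T)"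
  unfolding vt_def gam_def phi_def QU_step by (simp add: zt_def st_def len_step_weighted_sum)

lemma zs_carrier': "xs @\<^sub>v ys \<in> carrier_vec n"
  using xs_carrier ys_carrier by simp

lemma beta_nonneg: "\<beta> \<ge> 0"
  using start vnorm_ge_0 order.trans by blast

lemma Gamma_pos: "\<Gamma> > 0"
proof -
  have "9 * \<rho> * \<beta> * real m \<ge> 0" using rho_pos beta_nonneg by simp
  then show ?thesis using \<Gamma> by linarith
qed

lemma gam_pos: "gam t > 0"
  unfolding gam_def binary_search_def using bisect_pos[of 0 \<Gamma>] Gamma_pos by simp

lemma QU_snapshot: "QU t = schur (jacobian F (zt (t - t mod m)))"
proof (induction t)
  case 0
  then show ?case by (simp add: QU_step)
next
  case (Suc t)
  show ?case
  proof (cases "Suc t mod m = 0")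
    case True
    then show ?thesis by (simp add: QU_step)
  next
    case False
    then have "Suc t mod m = Suc (t mod m)" by (simp add: mod_Suc split: if_splits)
    then have "Suc t - Suc t mod m = t - t mod m" by simp
    moreover have "QU (Suc t) = QU t" using False by (simp add: QU_step[of "Suc t"]) (simp add: QU_def)
    ultimately show ?thesis using Suc by simp
  qed
qed

lemma jacobian_carrier: "z \<in> carrier_vec n \<Longrightarrow> jacobian F z \<in> carrier_mat n n"
  by (rule DF_carrier)

lemma QU_solve:
  assumes "zt (t - t mod m) \<in> carrier_vec n" "\<gamma> > 0" "b \<in> carrier_vec n"
  shows "schur_solve (QU t) \<gamma> b \<in> carrier_vec n"
    "jacobian F (zt (t - t mod m)) *\<^sub>v schur_solve (QU t) \<gamma> b + \<gamma> \<cdot>\<^sub>v schur_solve (QU t) \<gamma> b = b"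
  using schur_solve_correct[OF saddle_field_jacobian_monotone[OF assms(1)] assms(2,3)
      schur[OF jacobian_carrier[OF assms(1)]]] by (simp_all add: QU_snapshot)

text \<open>Strong induction, since a step refers back to the snapshot as well as to its
  predecessor. Positivity of the weights suffices here, so this precedes boundedness.\<close>

lemma zt_carrier: "zt t \<in> carrier_vec n"
proof (induction t rule: less_induct)
  case (less t)
  show ?case
  proof (cases t)
    case 0
    then show ?thesis using z0 by (simp add: zt_def st_def)
  next
    case (Suc k)
    have zk: "zt k \<in> carrier_vec n" and zp: "zt (k - k mod m) \<in> carrier_vec n"
      using less Suc by auto
    have "vt k \<in> carrier_vec n"
      unfolding vt_def by (rule QU_solve(1)[OF zp gam_pos saddle_field_carrier[OF zk]])
    then have "F (zt k - vt k) \<in> carrier_vec n"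
      by (intro saddle_field_carrier minus_carrier_vec zk)
    then show ?thesis unfolding Suc zt_Suc using zk by (intro minus_carrier_vec) auto
  qed
qed

lemmas Fz_carrier = saddle_field_carrier[OF zt_carrier]

lemma vt_carrier: "vt t \<in> carrier_vec n"
  unfolding vt_def by (rule QU_solve(1)[OF zt_carrier gam_pos Fz_carrier])

lemma vt_solve: "jacobian F (zt (t - t mod m)) *\<^sub>v vt t + gam t \<cdot>\<^sub>v vt t = F (zt t)"
  unfolding vt_def by (rule QU_solve(2)[OF zt_carrier gam_pos Fz_carrier])

text \<open>With q = \<rho> \<beta> m, multiplying the Newton step bound by M gives \<Gamma> M |v|
  <= 6 q \<Gamma> + 9 q^2, and \<Gamma> >= 9 q bounds this by 7 q \<Gamma> <= \<Gamma>^2.\<close>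

lemma phi_Gamma_nonpos:
  assumes "\<And>i. i \<le> t \<Longrightarrow> vnorm (zt i - (xs @\<^sub>v ys)) \<le> \<beta>"
  shows "fst (phi t \<Gamma>) \<le> 0"
proof -
  define v where "v = schur_solve (QU t) \<Gamma> (F (zt t))"
  define q where "q = \<rho> * \<beta> * real m"
  have q: "q \<ge> 0" using rho_pos beta_nonneg by (simp add: q_def)
  have G: "\<Gamma> \<ge> 9 * q" using \<Gamma> by (simp add: q_def mult_ac)
  have "\<Gamma> * vnorm v \<le> 2 * \<Gamma> * \<beta> + 3 * \<rho> * \<beta>\<^sup>2"
    by (rule lazy_newton_step_bound[OF zt_carrier[of t] _ zt_carrier[of "t - t mod m"] _ _ Gamma_pos])
      (use assms QU_solve[OF zt_carrier Gamma_pos Fz_carrier] in \<open>auto simp: v_def\<close>)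
  then have "(3 * \<rho> * real m) * (\<Gamma> * vnorm v) \<le> (3 * \<rho> * real m) * (2 * \<Gamma> * \<beta> + 3 * \<rho> * \<beta>\<^sup>2)"
    using rho_pos by (intro mult_left_mono) auto
  also have "\<dots> = 6 * q * \<Gamma> + 9 * (q * (\<rho> * \<beta>))"
    by (simp add: q_def power2_eq_square algebra_simps)
  also have "\<rho> * \<beta> * 1 \<le> q"
    unfolding q_def using m rho_pos beta_nonneg by (intro mult_left_mono) auto
  then have "q * (\<rho> * \<beta>) \<le> q * q" using q by (intro mult_left_mono) auto
  then have "6 * q * \<Gamma> + 9 * (q * (\<rho> * \<beta>)) \<le> 6 * q * \<Gamma> + q * (9 * q)" by simp
  also have "q * (9 * q) \<le> q * \<Gamma>" using G q by (intro mult_left_mono) auto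
  also have "6 * q * \<Gamma> + q * \<Gamma> \<le> (9 * q) * \<Gamma>" using q Gamma_pos by simp
  also have "\<dots> \<le> \<Gamma> * \<Gamma>" using G Gamma_pos by (intro mult_right_mono) auto
  finally have "\<Gamma> * (3 * \<rho> * real m * vnorm v) \<le> \<Gamma> * \<Gamma>" by (simp add: mult_ac)
  then show ?thesis using Gamma_pos by (simp add: phi_def v_def)
qed

text \<open>If \<gamma> > 2 tol, the lower end l is at least \<gamma>/2 and was evaluated with l < M
  |u|. Then \<gamma>^2 / 4 <= l^2 <= M l |u| <= M \<gamma> |v| by the resolvent comparison, whence
  the factor 4.\<close>

lemma search_result:
  assumes "\<And>i. i \<le> t \<Longrightarrow> vnorm (zt i - (xs @\<^sub>v ys)) \<le> \<beta>"
  shows "3 * \<rho> * real m * vnorm (vt t) \<le> gam t"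
    and "gam t \<le> 2 * tol \<or> gam t \<le> 4 * (3 * \<rho> * real m) * vnorm (vt t)"
proof -
  note br = binary_search_bracket[OF Gamma_pos tol phi_Gamma_nonpos[OF assms] gam_def[symmetric]]
  show "3 * \<rho> * real m * vnorm (vt t) \<le> gam t" using br by (simp add: phi_def vt_def)
  obtain l where l: "l \<ge> 0" "l \<le> gam t" "gam t - l \<le> tol" "l = 0 \<or> fst (phi t l) > 0"
    using br by blast
  show "gam t \<le> 2 * tol \<or> gam t \<le> 4 * (3 * \<rho> * real m) * vnorm (vt t)"
  proof (cases "gam t \<le> 2 * tol")
    case False
    then have lg: "gam t / 2 \<le> l" using l by linarith
    then have l0: "l > 0" using gam_pos[of t] by linarith
    define M where "M = 3 * \<rho> * real m"
    define u where "u = schur_solve (QU t) l (F (zt t))"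
    have u: "u \<in> carrier_vec n" "jacobian F (zt (t - t mod m)) *\<^sub>v u + l \<cdot>\<^sub>v u = F (zt t)"
      using QU_solve[OF zt_carrier l0 Fz_carrier] by (simp_all add: u_def)
    have M: "M \<ge> 0" using rho_pos by (simp add: M_def)
    have Mu: "l \<le> M * vnorm u" using l(4) l0 by (simp add: phi_def u_def M_def)
    have "l * vnorm u \<le> gam t * vnorm (vt t)"
      by (rule resolvent_norm_ratio[OF saddle_field_jacobian_monotone[OF zt_carrier[of "t - t mod m"]] l0 l(2) u(1) vt_carrier])
        (use u(2) vt_solve in simp)
    then have "M * (l * vnorm u) \<le> M * (gam t * vnorm (vt t))" using M by (rule mult_left_mono)
    moreover have "l * l \<le> l * (M * vnorm u)" using Mu l0 by (intro mult_left_mono) auto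
    moreover have "(gam t / 2) * (gam t / 2) \<le> l * l" using lg gam_pos[of t] by (intro mult_mono) auto
    ultimately have "gam t * gam t \<le> gam t * (4 * M * vnorm (vt t))" by (simp add: mult_ac)
    then show ?thesis using gam_pos[of t] by (simp add: M_def)
  qed simp
qed

lemma start': "vnorm (zt 0 - (xs @\<^sub>v ys)) \<le> \<beta>"
  using start by (simp add: zt_def st_def)

lemmas run_assms = m zt_carrier vt_carrier gam_pos vt_solve zt_Suc search_result(1) start'

lemma zt_bounded: "vnorm (zt t - (xs @\<^sub>v ys)) \<le> \<beta>"
  by (rule run_bounded[OF run_assms])

text \<open>The constant 7 covers (4 M)^2 times 7/3 \<beta>^2, as 16 * 7/3 < 49.\<close>

lemma weights_large:
  assumes T: "T \<ge> 1" and B: "B > 0" and tolB: "2 * tol * B \<le> 1"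
    and big: "(7 * B * (3 * \<rho> * real m) * \<beta>)\<^sup>2 \<le> real T ^ 3"
  shows "B \<le> (\<Sum>t<T. 1 / gam t)"
proof (rule weight_sum_ge[OF gam_pos B T search_result(2)[OF zt_bounded] tolB run_step_sum[OF run_assms]])
  define M where "M = 3 * \<rho> * real m"
  have "B\<^sup>2 * ((4 * M)\<^sup>2 * (7/3 * \<beta>\<^sup>2)) \<le> (7 * B * M * \<beta>)\<^sup>2"
    by (simp add: power_mult_distrib mult_ac)
  then show "B\<^sup>2 * ((4 * (3 * \<rho> * real m))\<^sup>2 * (7/3 * \<beta>\<^sup>2)) \<le> real T ^ 3"
    using big by (simp add: M_def)
qed

text \<open>The radius r must reach the averaged half steps, at distance 3 \<beta>, and meet the
  prescribed \<kappa>. R bounds the distance from the start to any pair in the two balls; its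
  summand 1 keeps it positive for \<beta> = 0. The regret R^2 / 2 divided by the weight sum is at
  most \<epsilon> once that sum reaches R^2 / (2 \<epsilon>), and the tolerance is matched to this
  threshold.\<close>

lemma len_eps_saddle:
  fixes \<epsilon> \<kappa> :: real and T :: nat and x0 y0 :: "real vec"
  defines "r \<equiv> max \<kappa> 3 * \<beta>"
  defines "R \<equiv> \<beta> + 2 * r + 1"
  assumes \<epsilon>: "\<epsilon> > 0" and \<kappa>: "\<kappa> > 0" and T: "T \<ge> 1"
    and split: "z0 = x0 @\<^sub>v y0" "x0 \<in> carrier_vec dx" "y0 \<in> carrier_vec dy"
    and tol_small: "tol \<le> \<epsilon> / R\<^sup>2"
    and big: "(7 * (R\<^sup>2 / (2 * \<epsilon>)) * (3 * \<rho> * real m) * \<beta>)\<^sup>2 \<le> real T ^ 3"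
  shows "eps_saddle \<kappa> dx dy f xs ys x0 y0 \<epsilon> (fst (len p schur F \<Gamma> tol z0 T m (3 * \<rho> * real m)))"
proof -
  have r: "r \<ge> 0" "3 * \<beta> \<le> r" "\<kappa> * \<beta> \<le> r"
    using beta_nonneg by (auto simp: r_def intro!: mult_right_mono)
  have R: "R \<ge> 1" "\<beta> + 2 * r \<le> R" using r beta_nonneg by (auto simp: R_def)
  define B where "B = R\<^sup>2 / (2 * \<epsilon>)"
  define W where "W = (\<Sum>t<T. 1 / gam t)"
  have B: "B > 0" using R \<epsilon> by (simp add: B_def)
  have "tol * R\<^sup>2 \<le> \<epsilon>" using tol_small R by (simp add: pos_le_divide_eq)
  then have "2 * tol * B \<le> 1" using \<epsilon> by (simp add: B_def field_simps)
  then have WB: "B \<le> W"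
    unfolding W_def by (intro weights_large[OF T B]) (use big in \<open>simp_all add: B_def\<close>)
  then have W: "W > 0" using B by linarith
  define zh where "zh = (1 / W) \<cdot>\<^sub>v weighted_sum (st T)"
  have len: "fst (len p schur F \<Gamma> tol z0 T m (3 * \<rho> * real m)) = zh"
    by (simp add: len_def Let_def zh_def W_def weight_sum_eq[symmetric] st_def)
  have ws0: "weighted_sum (st 0) = 0\<^sub>v n" using z0 by (simp add: st_def)
  have ws: "weighted_sum (st t) \<in> carrier_vec n" for t
    by (induction t) (auto simp: ws0 weighted_sum_Suc zt_carrier vt_carrier intro!: minus_carrier_vec)
  have zh: "zh \<in> carrier_vec n" using ws by (simp add: zh_def)
  have half: "zt t - vt t \<in> carrier_vec n" for t by (intro minus_carrier_vec zt_carrier vt_carrier)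
  have inv_pos: "1 / gam t > 0" for t using gam_pos by simp
  note jensen = convex_weighted_average[where c = "\<lambda>t. 1 / gam t" and p = "\<lambda>t. zt t - vt t"
      and ws = "\<lambda>t. weighted_sum (st t)", OF inv_pos half ws0 weighted_sum_Suc _ T,
      folded W_def, folded zh_def]
  have "W * vnorm (zh - (xs @\<^sub>v ys)) \<le> (\<Sum>t<T. 1 / gam t * vnorm (zt t - vt t - (xs @\<^sub>v ys)))"
    by (rule jensen[OF convex_fun_vnorm_diff[OF zs_carrier']])
  also have "\<dots> \<le> (\<Sum>t<T. 1 / gam t * (3 * \<beta>))"
    by (intro sum_mono mult_left_mono run_half_bounded[OF run_assms]) (auto simp: less_imp_le gam_pos)
  also have "\<dots> = W * (3 * \<beta>)" by (simp add: W_def sum_distrib_right)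
  finally have near: "vnorm (zh - (xs @\<^sub>v ys)) \<le> 3 * \<beta>" using W by simp
  define xh yh where "xh = vec_first zh dx" and "yh = vec_last zh dy"
  have xyh: "xh \<in> carrier_vec dx" "yh \<in> carrier_vec dy" "zh = xh @\<^sub>v yh"
    using zh by (auto simp: xh_def yh_def)
  have "zh - (xs @\<^sub>v ys) = (xh - xs) @\<^sub>v (yh - ys)"
    unfolding xyh(3) by (rule append_vec_minus[OF xyh(1) xs_carrier xyh(2) ys_carrier])
  then have hat: "vnorm (xh - xs) \<le> r" "vnorm (yh - ys) \<le> r"
    using vnorm_append_ge[of "xh - xs" dx "yh - ys" dy] near r xyh xs_carrier ys_carrier
    by (simp_all add: minus_carrier_vec)
  have "z0 - (xs @\<^sub>v ys) = (x0 - xs) @\<^sub>v (y0 - ys)"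
    unfolding split(1) by (rule append_vec_minus[OF split(2) xs_carrier split(3) ys_carrier])
  then have "vnorm (x0 - xs) \<le> \<beta>" "vnorm (y0 - ys) \<le> \<beta>"
    using vnorm_append_ge[of "x0 - xs" dx "y0 - ys" dy] start split xs_carrier ys_carrier
    by (simp_all add: minus_carrier_vec)
  then have "\<kappa> * max (vnorm (x0 - xs)) (vnorm (y0 - ys)) \<le> \<kappa> * \<beta>"
    using \<kappa> by (intro mult_left_mono) auto
  then have kap: "\<kappa> * max (vnorm (x0 - xs)) (vnorm (y0 - ys)) \<le> r" using r by simp
  have pair: "f xh y - f x yh \<le> \<epsilon>" if xb: "x \<in> vball xs r" and yb: "y \<in> vball ys r" for x y
  proof -
    have x: "x \<in> carrier_vec dx" "vnorm (x - xs) \<le> r" and y: "y \<in> carrier_vec dy" "vnorm (y - ys) \<le> r"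
      using xb yb xs_carrier ys_carrier by (auto simp: vball_def)
    define w where "w = x @\<^sub>v y"
    have w: "w \<in> carrier_vec n" using x y by (simp add: w_def)
    have "w - (xs @\<^sub>v ys) = (x - xs) @\<^sub>v (y - ys)"
      unfolding w_def by (rule append_vec_minus[OF x(1) xs_carrier y(1) ys_carrier])
    then have "vnorm (w - (xs @\<^sub>v ys)) \<le> 2 * r"
      using vnorm_append_le[of "x - xs" dx "y - ys" dy] x y xs_carrier ys_carrier
      by (simp add: minus_carrier_vec)
    then have "vnorm (z0 - w) \<le> R"
      using vnorm_diff_triangle[OF z0 zs_carrier' w] vnorm_minus_commute[OF w zs_carrier'] start R by simp
    then have sq: "(vnorm (z0 - w))\<^sup>2 \<le> R\<^sup>2" by (intro power_mono) auto
    have "W * (f xh y - f x yh)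
        \<le> (\<Sum>t<T. 1 / gam t * (f (vec_first (zt t - vt t) dx) y - f x (vec_last (zt t - vt t) dy)))"
      using jensen[OF convex_fun_gap[OF x(1) y(1)]] by (simp add: xh_def yh_def)
    also have "\<dots> \<le> (\<Sum>t<T. 1 / gam t * (F (zt t - vt t) \<bullet> (zt t - vt t - w)))"
      unfolding w_def
      by (intro sum_mono mult_left_mono saddle_field_gap_le half x y) (auto simp: less_imp_le gam_pos)
    also have "\<dots> \<le> (vnorm (zt 0 - w))\<^sup>2 / 2"
      by (rule run_regret[OF run_assms w])
    also have "\<dots> \<le> R\<^sup>2 / 2" using sq by (simp add: zt_def st_def)
    also have "\<dots> = B * \<epsilon>" using \<epsilon> by (simp add: B_def)
    also have "\<dots> \<le> W * \<epsilon>" using WB \<epsilon> by (intro mult_right_mono) auto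
    finally show ?thesis using W by simp
  qed
  have ne: "xs \<in> vball xs r" "ys \<in> vball ys r"
    using r xs_carrier ys_carrier by (auto simp: vball_def)
  \<comment> \<open>The pairwise bound and nonempty balls suffice for both extrema; no compactness
    or attainment is used.\<close>
  have "(SUP y\<in>vball ys r. f xh y) - \<epsilon> \<le> (INF x\<in>vball xs r. f x yh)"
  proof (rule cINF_greatest)
    fix x assume x: "x \<in> vball xs r"
    have "(SUP y\<in>vball ys r. f xh y) \<le> f x yh + \<epsilon>"
      by (rule cSUP_least) (use ne pair[OF x] in \<open>auto simp: algebra_simps\<close>)
    then show "(SUP y\<in>vball ys r. f xh y) - \<epsilon> \<le> f x yh" by simp
  qed (use ne in auto)
  then have "gap f xs ys xh yh r \<le> \<epsilon>" by (simp add: gap_def)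
  then show ?thesis
    unfolding len eps_saddle_def Let_def xh_def[symmetric] yh_def[symmetric]
    using zh kap hat by (intro conjI exI[of _ r]) auto
qed

end

end

section \<open>Counting the price\<close>

text \<open>The complexity bound concerns every dimension, not only large ones. The finitely many
  exceptional ratios are added to the constant.\<close>

lemma bigo_nat_bound:
  fixes g h :: "nat \<Rightarrow> real"
  assumes "g \<in> O(h)" and h: "\<And>d. d \<ge> 1 \<Longrightarrow> h d > 0"
  shows "\<exists>C>0. \<forall>d\<ge>1. \<bar>g d\<bar> \<le> C * h d"
proof -
  obtain c where c: "c > 0" "eventually (\<lambda>d. norm (g d) \<le> c * norm (h d)) at_top"
    using landau_o.bigE[OF assms(1)] by blast
  obtain N where N: "\<And>d. d \<ge> N \<Longrightarrow> \<bar>g d\<bar> \<le> c * \<bar>h d\<bar>"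
    using c(2) by (auto simp: eventually_at_top_linorder)
  define C where "C = c + (\<Sum>i<N. \<bar>g i\<bar> / \<bar>h i\<bar>)"
  have sum0: "(\<Sum>i<N. \<bar>g i\<bar> / \<bar>h i\<bar>) \<ge> 0" by (intro sum_nonneg) auto
  have "\<bar>g d\<bar> \<le> C * h d" if d: "d \<ge> 1" for d
  proof (cases "d \<ge> N")
    case True
    have "c * h d \<le> C * h d" using sum0 h[OF d] by (intro mult_right_mono) (auto simp: C_def)
    moreover have "\<bar>g d\<bar> \<le> c * h d" using N[OF True] h[OF d] by simp
    ultimately show ?thesis by linarith
  next
    case False
    then have "\<bar>g d\<bar> / \<bar>h d\<bar> \<le> (\<Sum>i<N. \<bar>g i\<bar> / \<bar>h i\<bar>)"
      by (intro member_le_sum) auto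
    then have "\<bar>g d\<bar> / h d \<le> C" using c h[OF d] by (simp add: C_def)
    then show ?thesis using h[OF d] by (simp add: pos_divide_le_eq)
  qed
  moreover have "C > 0" using c sum0 by (simp add: C_def)
  ultimately show ?thesis by blast
qed

text \<open>The argument is at least 3 >= exp 1, so additive constants can be absorbed into the
  logarithm.\<close>

lemma ln_search_arg_ge_1:
  assumes "\<epsilon> > 0" "d \<ge> 1"
  shows "1 \<le> ln (real d + 1 / \<epsilon> + 2)"
proof -
  have "1 / \<epsilon> > 0" "real d \<ge> 1" using assms by simp_all
  then have "real d + 1 / \<epsilon> + 2 > 0" "exp 1 \<le> real d + 1 / \<epsilon> + 2"
    using exp_le by linarith+
  then show ?thesis by (simp add: ln_ge_iff)
qed

text \<open>Both d and 1 / \<epsilon> are at most the argument s of the logarithm, so u <= q s^2.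
  The final 2 pays for rounding up and for the solve after the search.\<close>

lemma search_length_le:
  fixes q \<epsilon> u :: real
  assumes q: "q > 0" and \<epsilon>: "\<epsilon> > 0" and d: "d \<ge> 1" and u: "u > 0" "u \<le> q * real d / \<epsilon>"
  shows "real (nat \<lceil>log 2 u\<rceil>) + 1 \<le> ((\<bar>ln q\<bar> + 2) / ln 2 + 2) * ln (real d + 1 / \<epsilon> + 2)"
proof -
  define s where "s = real d + 1 / \<epsilon> + 2"
  define L where "L = ln s"
  have L: "L \<ge> 1" unfolding L_def s_def by (rule ln_search_arg_ge_1[OF \<epsilon> d])
  have "1 / \<epsilon> > 0" using \<epsilon> by simp
  then have s: "s > 0" "real d \<le> s" "1 / \<epsilon> \<le> s" unfolding s_def by linarith+
  have "real d / \<epsilon> \<le> s * s"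
    using mult_mono[OF s(2,3)] s \<epsilon> by simp
  then have "u \<le> q * (s * s)" using u q by (metis mult_left_mono less_imp_le order.trans times_divide_eq_right)
  then have "ln u \<le> ln (q * (s * s))" using u by (intro ln_mono) auto
  also have "\<dots> = ln q + 2 * L" using q s by (simp add: ln_mult L_def)
  also have "\<dots> \<le> \<bar>ln q\<bar> * L + 2 * L"
    using L mult_left_mono[of 1 L "\<bar>ln q\<bar>"] by simp
  finally have "ln u \<le> (\<bar>ln q\<bar> + 2) * L" by (simp add: algebra_simps)
  then have lg: "log 2 u \<le> (\<bar>ln q\<bar> + 2) / ln 2 * L"
    by (simp add: log_def divide_right_mono)
  have nn: "0 \<le> (\<bar>ln q\<bar> + 2) / ln 2 * L" using L by (intro mult_nonneg_nonneg) auto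
  have "real (nat \<lceil>log 2 u\<rceil>) \<le> (\<bar>ln q\<bar> + 2) / ln 2 * L + 1"
    using lg nn by linarith
  then show ?thesis using L unfolding s_def[symmetric] L_def[symmetric] by (simp add: distrib_right)
qed

lemma cube_of_powr_two_thirds:
  fixes x :: real
  assumes "x \<ge> 0"
  shows "(x powr (2/3)) ^ 3 = x\<^sup>2"
proof (cases "x = 0")
  case False
  then show ?thesis using assms by (simp add: powr_power)
qed simp

text \<open>Rounding up and the extra step cost 2, which is charged to the summand d.\<close>

lemma steps_le:
  fixes a x \<epsilon> :: real
  assumes a: "a \<ge> 0" and \<epsilon>: "\<epsilon> > 0" and d: "d \<ge> 1" and x: "0 \<le> x" "x \<le> a * real d / \<epsilon>"
  shows "real (nat \<lceil>x powr (2/3)\<rceil> + 1)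
    \<le> (a powr (2/3) + 2) * (real d + real d powr (2/3) * \<epsilon> powr (- (2/3)))"
proof -
  define Y where "Y = real d powr (2/3) * \<epsilon> powr (- (2/3))"
  have Y: "Y \<ge> 0" by (simp add: Y_def)
  have "x powr (2/3) \<le> (a * real d / \<epsilon>) powr (2/3)" using x by (intro powr_mono2) auto
  also have "\<dots> = a powr (2/3) * Y"
  proof -
    define r :: real where "r = 2/3"
    have "(a * real d / \<epsilon>) powr r = (a * real d) powr r / \<epsilon> powr r"
      by (rule powr_divide)
    also have "(a * real d) powr r = a powr r * real d powr r"
      by (rule powr_mult)
    finally show ?thesis
      unfolding Y_def r_def[symmetric] powr_minus by (simp add: divide_inverse mult.assoc)
  qed
  finally have le: "x powr (2/3) \<le> a powr (2/3) * Y" .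
  have "real (nat \<lceil>x powr (2/3)\<rceil> + 1) \<le> x powr (2/3) + 2"
    using powr_ge_zero[of x "2/3"] by linarith
  also have "\<dots> \<le> a powr (2/3) * (real d + Y) + 2 * (real d + Y)"
  proof (intro add_mono)
    show "x powr (2/3) \<le> a powr (2/3) * (real d + Y)"
      using le by (simp add: distrib_left add_increasing)
    show "2 \<le> 2 * (real d + Y)" using d Y by simp
  qed
  finally show ?thesis by (simp add: Y_def algebra_simps)
qed

text \<open>P is the price scale of a step, X the scale of the step count and L the logarithm. A
  snapshot costs O(d P), that is, as much as d steps.\<close>

lemma total_price_le:
  fixes N P X L S Q Tr a' b c1 vo ps sd :: real and d m T k :: nat
  assumes N: "N \<ge> 0" and d: "d \<ge> 1" and m: "m \<ge> 1" and dm: "real d \<le> c1 * real m"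
    and nonneg: "a' \<ge> 0" "b \<ge> 0" "S \<ge> 0" "Q \<ge> 0" "c1 \<ge> 0"
    and X: "real d \<le> X" and L: "1 \<le> L" and P: "P = N + real d ^ 2"
    and T: "real T \<le> a' * X" and k: "real k + 1 \<le> b * L"
    and sd: "sd \<le> S * real d ^ 3" and ps: "ps \<le> Q * real d ^ 2" and vo: "vo \<le> Q * real d ^ 2"
  shows "real ((T + m - 1) div m) * (N * real d + sd)
      + real T * (2 * N + (real k + 1) * ps + 4 * vo) + vo
    \<le> ((1 + S) * (c1 * a' + 1) + a' * (2 + Q * b + 4 * Q) + Q) * (P * X) * L"
proof -
  have P1: "real d ^ 2 \<le> P" "N \<le> P" "0 \<le> P" using N by (auto simp: P)
  have X1: "1 \<le> X" using X d by linarith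
  have PX: "P \<le> P * X" using P1 X1 mult_left_mono[of 1 X P] by simp
  have PL: "P \<le> P * L" using P1 L mult_left_mono[of 1 L P] by simp
  have PXL: "P * X \<le> P * X * L" using P1 X1 L mult_left_mono[of 1 L "P * X"] by simp
  have snap: "N * real d + sd \<le> (1 + S) * (real d * P)"
  proof -
    have "N * real d + sd \<le> N * real d + S * (real d * real d ^ 2)" using sd by (simp add: power3_eq_cube power2_eq_square)
    also have "\<dots> \<le> P * real d + S * (real d * P)"
      using P1 nonneg by (intro add_mono mult_left_mono mult_right_mono) auto
    finally show ?thesis by (simp add: algebra_simps)
  qed
  \<comment> \<open>The rounded-up number of snapshots is at most T / m + 1. The first part uses d
    <= c1 m; the 1, for the initial snapshot, is why X must dominate d.\<close>
  have count: "real ((T + m - 1) div m) * real d \<le> (c1 * a' + 1) * X"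
  proof -
    have "real ((T + m - 1) div m) \<le> real (T + m - 1) / real m" by (rule of_nat_div_le_of_nat)
    also have "\<dots> \<le> real (T + m) / real m" using m by (intro divide_right_mono) auto
    also have "\<dots> = real T / real m + 1" using m by (simp add: field_simps)
    finally have "real ((T + m - 1) div m) * real d \<le> (real T / real m + 1) * real d"
      by (intro mult_right_mono) auto
    also have "\<dots> = real T * (real d / real m) + real d" by (simp add: algebra_simps)
    also have "\<dots> \<le> (a' * X) * c1 + X"
      using T X dm m nonneg X1 by (intro add_mono mult_mono) (auto simp: pos_divide_le_eq)
    finally show ?thesis by (simp add: algebra_simps)
  qed
  have "real ((T + m - 1) div m) * (N * real d + sd) \<le> real ((T + m - 1) div m) * ((1 + S) * (real d * P))"
    using snap by (intro mult_left_mono) auto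
  also have "\<dots> = (1 + S) * P * (real ((T + m - 1) div m) * real d)" by (simp add: mult_ac)
  also have "\<dots> \<le> (1 + S) * P * ((c1 * a' + 1) * X)"
    using count nonneg P1 by (intro mult_left_mono) auto
  also have "\<dots> = (1 + S) * (c1 * a' + 1) * (P * X)" by (simp add: mult_ac)
  also have "\<dots> \<le> (1 + S) * (c1 * a' + 1) * (P * X * L)"
    using PXL nonneg by (intro mult_left_mono) auto
  finally have 1: "real ((T + m - 1) div m) * (N * real d + sd) \<le> (1 + S) * (c1 * a' + 1) * (P * X * L)" .
  have voP: "vo \<le> Q * P"
    using vo P1 nonneg mult_left_mono[of "real d ^ 2" P Q] by linarith
  have psP: "ps \<le> Q * P"
    using ps P1 nonneg mult_left_mono[of "real d ^ 2" P Q] by linarith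
  have "(real k + 1) * ps \<le> (real k + 1) * (Q * P)" using psP by (intro mult_left_mono) auto
  also have "\<dots> \<le> (b * L) * (Q * P)" using k nonneg P1 by (intro mult_right_mono) auto
  finally have kp: "(real k + 1) * ps \<le> Q * b * (P * L)" by (simp add: mult_ac)
  have "Q * P \<le> Q * (P * L)" using PL nonneg by (intro mult_left_mono) auto
  then have iter: "2 * N + (real k + 1) * ps + 4 * vo \<le> (2 + Q * b + 4 * Q) * (P * L)"
    using kp voP P1 PL by (simp add: distrib_right)
  have "real T * (2 * N + (real k + 1) * ps + 4 * vo) \<le> real T * ((2 + Q * b + 4 * Q) * (P * L))"
    using iter by (intro mult_left_mono) auto
  also have "\<dots> \<le> (a' * X) * ((2 + Q * b + 4 * Q) * (P * L))"
    using T nonneg P1 L by (intro mult_right_mono) auto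
  finally have 2: "real T * (2 * N + (real k + 1) * ps + 4 * vo) \<le> a' * (2 + Q * b + 4 * Q) * (P * X * L)"
    by (simp add: mult_ac)
  have "vo \<le> Q * (P * X * L)"
    using voP PX PXL nonneg mult_left_mono[of P "P * X * L" Q] by linarith
  with 1 2 show ?thesis by (simp add: distrib_right mult.assoc)
qed

theorem theorem4p3:
  fixes \<rho> \<beta> \<kappa> :: real
    and m :: "nat \<Rightarrow> nat"
    and schur_price tri_price matvec_price vecop_price :: "nat \<Rightarrow> real"
  assumes "\<rho> > 0" and "\<beta> \<ge> 0" and "\<kappa> > 0"
    and "\<And>d. d \<ge> 1 \<Longrightarrow> m d \<ge> 1"
    and "(\<lambda>d. real (m d)) \<in> \<Theta>(\<lambda>d. real d)"
    and "schur_price \<in> O(\<lambda>d. real d ^ 3)"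
    and "tri_price \<in> O(\<lambda>d. real d ^ 2)"
    and "matvec_price \<in> O(\<lambda>d. real d ^ 2)"
    and "vecop_price \<in> O(\<lambda>d. real d)"
  shows "\<exists>C>0. \<exists>k::nat. \<forall>dx\<ge>1. \<forall>dy\<ge>1. \<forall>\<epsilon>>0.
    (let d = dx + dy; M = 3 * \<rho> * real (m d) in
     \<exists>T \<Gamma> tol. \<Gamma> > 0 \<and> tol > 0 \<and>
      (\<forall>f x0 y0 xs ys N schur.
        twice_cont_diff d (joint dx dy f) \<and>
        lipschitz_hessian d \<rho> (joint dx dy f) \<and>
        (\<forall>y\<in>carrier_vec dy. convex_fun dx (\<lambda>x. f x y)) \<and>
        (\<forall>x\<in>carrier_vec dx. concave_fun dy (\<lambda>y. f x y)) \<and>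
        is_saddle dx dy f xs ys \<and>
        x0 \<in> carrier_vec dx \<and> y0 \<in> carrier_vec dy \<and>
        vnorm ((x0 @\<^sub>v y0) - (xs @\<^sub>v ys)) = \<beta> \<and>
        N \<ge> 0 \<and>
        (\<forall>A\<in>carrier_mat d d. is_schur d A (schur A))
        \<longrightarrow>
        (let F = saddle_field dx dy f; z0 = x0 @\<^sub>v y0;
             p = \<lparr> eval_F = N, eval_DF = N * real d,
                   schur_dec = schur_price d, tri = tri_price d,
                   matvec = matvec_price d, vecop = vecop_price d \<rparr>
         in (\<forall>\<Gamma>'\<ge>\<Gamma>. \<forall>tol'. 0 < tol' \<and> tol' \<le> tol \<longrightarrow>
               eps_saddle \<kappa> dx dy f xs ys x0 y0 \<epsilon> (fst (len p schur F \<Gamma>' tol' z0 T (m d) M))) \<and>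
            snd (len p schur F \<Gamma> tol z0 T (m d) M)
              \<le> C * ((N + real d ^ 2) * (real d + real d powr (2/3) * \<epsilon> powr (- (2/3))))
                  * ln (real d + 1 / \<epsilon> + 2) ^ k)))"
proof -
  \<comment> \<open>The upper half of \<Theta> controls the step count and \<Gamma>; the lower half,
    in c1, controls the snapshots.\<close>
  obtain c2 where c2: "c2 > 0" "\<And>d. d \<ge> 1 \<Longrightarrow> real (m d) \<le> c2 * real d"
    using bigo_nat_bound[OF bigthetaD1[OF assms(5)]] by fastforce
  have "(\<lambda>d. real d) \<in> O(\<lambda>d. real (m d))"
    using bigthetaD2[OF assms(5)] by (simp add: bigomega_iff_bigo)
  moreover have "real (m d) > 0" if "d \<ge> 1" for d using assms(4)[OF that] by simp
  ultimately obtain c1 where c1: "c1 > 0" "\<And>d. d \<ge> 1 \<Longrightarrow> real d \<le> c1 * real (m d)"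
    using bigo_nat_bound[of "\<lambda>d. real d" "\<lambda>d. real (m d)"] by fastforce
  obtain S where S: "S > 0" "\<And>d. d \<ge> 1 \<Longrightarrow> \<bar>schur_price d\<bar> \<le> S * real d ^ 3"
    using bigo_nat_bound[OF assms(6)] by auto
  obtain Q1 where Q1: "Q1 > 0" "\<And>d. d \<ge> 1 \<Longrightarrow> \<bar>tri_price d\<bar> \<le> Q1 * real d ^ 2"
    using bigo_nat_bound[OF assms(7)] by auto
  obtain Q2 where Q2: "Q2 > 0" "\<And>d. d \<ge> 1 \<Longrightarrow> \<bar>matvec_price d\<bar> \<le> Q2 * real d ^ 2"
    using bigo_nat_bound[OF assms(8)] by auto
  obtain Q3 where Q3: "Q3 > 0" "\<And>d. d \<ge> 1 \<Longrightarrow> \<bar>vecop_price d\<bar> \<le> Q3 * real d"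
    using bigo_nat_bound[OF assms(9)] by auto
  define Q where "Q = 2 * Q2 + Q1 + Q3"
  define R where "R = \<beta> + 2 * (max \<kappa> 3 * \<beta>) + 1"
  have R: "R > 0" using assms(2,3) unfolding R_def by (intro add_nonneg_pos add_nonneg_nonneg mult_nonneg_nonneg) auto
  \<comment> \<open>Chosen so that \<Gamma> / tol <= q d / \<epsilon>, which bounds the number of
    halvings; \<open>a\<close> below plays the same part for the number of steps.\<close>
  define q where "q = (9 * \<rho> * \<beta> * c2 + 1) * R\<^sup>2"
  have "9 * \<rho> * \<beta> * c2 \<ge> 0" using assms(1,2) c2(1) by simp
  then have "9 * \<rho> * \<beta> * c2 + 1 > 0" by linarith
  then have q: "q > 0" using R by (simp add: q_def)
  define a where "a = 7 * R\<^sup>2 / 2 * 3 * \<rho> * \<beta> * c2"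
  have a: "a \<ge> 0" using assms(1,2) c2(1) by (simp add: a_def)
  define b where "b = (\<bar>ln q\<bar> + 2) / ln 2 + 2"
  define a' where "a' = a powr (2/3) + 2"
  define C where "C = (1 + S) * (c1 * a' + 1) + a' * (2 + Q * b + 4 * Q) + Q"
  have nonneg: "a' \<ge> 0" "b \<ge> 0" "S \<ge> 0" "Q \<ge> 0" "c1 \<ge> 0"
    using S(1) Q1(1) Q2(1) Q3(1) c1(1) by (auto simp: a'_def b_def Q_def)
  have "C > 0"
  proof -
    have "(1 + S) * (c1 * a' + 1) > 0"
      using nonneg S(1) by (intro mult_pos_pos add_nonneg_pos mult_nonneg_nonneg) auto
    moreover have "a' * (2 + Q * b + 4 * Q) \<ge> 0" using nonneg by simp
    ultimately show ?thesis using nonneg unfolding C_def by linarith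
  qed
  show ?thesis unfolding Let_def
  proof (rule exI[of _ C], rule conjI, rule \<open>C > 0\<close>, rule exI[of _ "1::nat"], intro allI impI)
    fix dx dy :: nat and \<epsilon> :: real
    assume dims: "dx \<ge> 1" "dy \<ge> 1" and \<epsilon>: "\<epsilon> > 0"
    define d where "d = dx + dy"
    have d: "d \<ge> 1" using dims by (simp add: d_def)
    define x where "x = 7 * (R\<^sup>2 / (2 * \<epsilon>)) * (3 * \<rho> * real (m d)) * \<beta>"
    \<comment> \<open>The weight argument asks for x^2 <= T^3. The added 1 guarantees a step even
      when x = 0, as for \<beta> = 0.\<close>
    define T where "T = nat \<lceil>x powr (2/3)\<rceil> + 1"
    define \<Gamma> where "\<Gamma> = 9 * \<rho> * \<beta> * real (m d) + 1"
    define tol where "tol = \<epsilon> / R\<^sup>2"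
    have x0: "x \<ge> 0" using assms(1,2) \<epsilon> by (simp add: x_def)
    have "x = 7 * R\<^sup>2 / 2 * 3 * \<rho> * \<beta> * real (m d) / \<epsilon>" by (simp add: x_def)
    also have "\<dots> \<le> 7 * R\<^sup>2 / 2 * 3 * \<rho> * \<beta> * (c2 * real d) / \<epsilon>"
      using c2(2)[OF d] assms(1,2) \<epsilon> by (intro divide_right_mono mult_left_mono) auto
    finally have xa: "x \<le> a * real d / \<epsilon>" by (simp add: a_def mult_ac)
    have T1: "T \<ge> 1" by (simp add: T_def)
    have "x\<^sup>2 = (x powr (2/3)) ^ 3" by (rule cube_of_powr_two_thirds[OF x0, symmetric])
    also have "\<dots> \<le> real T ^ 3" unfolding T_def by (intro power_mono) (linarith, simp)
    finally have big: "x\<^sup>2 \<le> real T ^ 3" .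
    have \<Gamma>: "\<Gamma> > 0" unfolding \<Gamma>_def using assms(1,2) by (intro add_nonneg_pos) auto
    have tol: "tol > 0" using \<epsilon> R by (simp add: tol_def)
    have "\<Gamma> \<le> 9 * \<rho> * \<beta> * (c2 * real d) + real d"
      unfolding \<Gamma>_def using c2(2)[OF d] assms(1,2) d by (intro add_mono mult_left_mono) auto
    also have "\<dots> = (9 * \<rho> * \<beta> * c2 + 1) * real d" by (simp add: algebra_simps)
    finally have "\<Gamma> * R\<^sup>2 / \<epsilon> \<le> (9 * \<rho> * \<beta> * c2 + 1) * real d * R\<^sup>2 / \<epsilon>"
      using \<epsilon> by (intro divide_right_mono mult_right_mono) auto
    then have ratio: "\<Gamma> / tol \<le> q * real d / \<epsilon>" by (simp add: tol_def q_def mult_ac)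
    have key: "(\<forall>\<Gamma>'\<ge>\<Gamma>. \<forall>tol'. 0 < tol' \<and> tol' \<le> tol \<longrightarrow>
          eps_saddle \<kappa> dx dy f xs ys x0 y0 \<epsilon>
            (fst (len p schur (saddle_field dx dy f) \<Gamma>' tol' (x0 @\<^sub>v y0) T (m d) (3 * \<rho> * real (m d))))) \<and>
        snd (len p schur (saddle_field dx dy f) \<Gamma> tol (x0 @\<^sub>v y0) T (m d) (3 * \<rho> * real (m d)))
          \<le> C * ((N + real d ^ 2) * (real d + real d powr (2/3) * \<epsilon> powr (- (2/3))))
             * ln (real d + 1 / \<epsilon> + 2) ^ 1"
      if H: "twice_cont_diff d (joint dx dy f) \<and>
        lipschitz_hessian d \<rho> (joint dx dy f) \<and>
        (\<forall>y\<in>carrier_vec dy. convex_fun dx (\<lambda>x. f x y)) \<and>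
        (\<forall>x\<in>carrier_vec dx. concave_fun dy (\<lambda>y. f x y)) \<and>
        is_saddle dx dy f xs ys \<and>
        x0 \<in> carrier_vec dx \<and> y0 \<in> carrier_vec dy \<and>
        vnorm ((x0 @\<^sub>v y0) - (xs @\<^sub>v ys)) = \<beta> \<and>
        N \<ge> 0 \<and> (\<forall>A\<in>carrier_mat d d. is_schur d A (schur A))"
      and p: "p = \<lparr> eval_F = N, eval_DF = N * real d, schur_dec = schur_price d, tri = tri_price d,
                   matvec = matvec_price d, vecop = vecop_price d \<rparr>"
      for f x0 y0 xs ys N schur p
    proof -
      interpret smooth_saddle dx dy f \<rho> xs ys
        using H assms(1) by unfold_locales (auto simp: d_def)
      have z0: "x0 @\<^sub>v y0 \<in> carrier_vec (dx + dy)" using H by simp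
      have "eps_saddle \<kappa> dx dy f xs ys x0 y0 \<epsilon>
            (fst (len p schur (saddle_field dx dy f) \<Gamma>' tol' (x0 @\<^sub>v y0) T (m d) (3 * \<rho> * real (m d))))"
        if "\<Gamma>' \<ge> \<Gamma>" "0 < tol' \<and> tol' \<le> tol" for \<Gamma>' tol'
      proof (rule len_eps_saddle[where \<beta> = \<beta>])
        show "(7 * ((\<beta> + 2 * (max \<kappa> 3 * \<beta>) + 1)\<^sup>2 / (2 * \<epsilon>)) * (3 * \<rho> * real (m d)) * \<beta>)\<^sup>2 \<le> real T ^ 3"
          using big by (simp add: x_def R_def)
        show "tol' \<le> \<epsilon> / (\<beta> + 2 * (max \<kappa> 3 * \<beta>) + 1)\<^sup>2"
          using that by (simp add: tol_def R_def)
      qed (use that H z0 \<epsilon> assms(3) T1 assms(4)[OF d] in \<open>auto simp: d_def \<Gamma>_def\<close>)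
      moreover have "snd (len p schur (saddle_field dx dy f) \<Gamma> tol (x0 @\<^sub>v y0) T (m d) (3 * \<rho> * real (m d)))
          \<le> C * ((N + real d ^ 2) * (real d + real d powr (2/3) * \<epsilon> powr (- (2/3))))
             * ln (real d + 1 / \<epsilon> + 2)"
      proof -
        have sq: "real d \<le> real d ^ 2" using d by (simp add: power2_eq_square)
        have vo: "vecop_price d \<le> Q3 * real d ^ 2"
          using Q3(2)[OF d] mult_left_mono[OF sq, of Q3] Q3(1) by linarith
        have ps: "2 * matvec_price d + tri_price d + vecop_price d \<le> Q * real d ^ 2"
          using vo Q1(2)[OF d] Q2(2)[OF d] by (simp add: Q_def distrib_right)
        have voQ: "vecop_price d \<le> Q * real d ^ 2"
          using vo Q1(1) Q2(1) mult_right_mono[of Q3 Q "real d ^ 2"] by (simp add: Q_def)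
        have sd: "schur_price d \<le> S * real d ^ 3" using S(2)[OF d] by linarith
        have Y: "real d \<le> real d + real d powr (2/3) * \<epsilon> powr (- (2/3))" by simp
        have Tb: "real T \<le> a' * (real d + real d powr (2/3) * \<epsilon> powr (- (2/3)))"
          unfolding T_def a'_def by (rule steps_le[OF a \<epsilon> d x0 xa])
        have kb: "real (nat \<lceil>log 2 (\<Gamma> / tol)\<rceil>) + 1 \<le> b * ln (real d + 1 / \<epsilon> + 2)"
          unfolding b_def by (rule search_length_le[OF q \<epsilon> d _ ratio]) (use \<Gamma> tol in auto)
        show ?thesis
          unfolding C_def
          using total_price_le[OF _ d assms(4)[OF d] c1(2)[OF d] nonneg Y ln_search_arg_ge_1[OF \<epsilon> d] refl
              Tb kb sd ps voQ, of N] H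
          by (simp add: len_def Let_def len_run_spent[OF assms(4)[OF d]] p solve_price_def)
      qed
      ultimately show ?thesis by simp
    qed
    show "\<exists>T \<Gamma> tol. \<Gamma> > 0 \<and> tol > 0 \<and>
      (\<forall>f x0 y0 xs ys N schur.
        twice_cont_diff (dx + dy) (joint dx dy f) \<and>
        lipschitz_hessian (dx + dy) \<rho> (joint dx dy f) \<and>
        (\<forall>y\<in>carrier_vec dy. convex_fun dx (\<lambda>x. f x y)) \<and>
        (\<forall>x\<in>carrier_vec dx. concave_fun dy (\<lambda>y. f x y)) \<and>
        is_saddle dx dy f xs ys \<and>
        x0 \<in> carrier_vec dx \<and> y0 \<in> carrier_vec dy \<and>
        vnorm ((x0 @\<^sub>v y0) - (xs @\<^sub>v ys)) = \<beta> \<and>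
        N \<ge> 0 \<and>
        (\<forall>A\<in>carrier_mat (dx + dy) (dx + dy). is_schur (dx + dy) A (schur A))
        \<longrightarrow>
        (\<forall>\<Gamma>'\<ge>\<Gamma>. \<forall>tol'. 0 < tol' \<and> tol' \<le> tol \<longrightarrow>
               eps_saddle \<kappa> dx dy f xs ys x0 y0 \<epsilon> (fst (len \<lparr> eval_F = N, eval_DF = N * real (dx + dy),
                   schur_dec = schur_price (dx + dy), tri = tri_price (dx + dy),
                   matvec = matvec_price (dx + dy), vecop = vecop_price (dx + dy) \<rparr> schur (saddle_field dx dy f)
                   \<Gamma>' tol' (x0 @\<^sub>v y0) T (m (dx + dy)) (3 * \<rho> * real (m (dx + dy)))))) \<and>
            snd (len \<lparr> eval_F = N, eval_DF = N * real (dx + dy),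
                   schur_dec = schur_price (dx + dy), tri = tri_price (dx + dy),
                   matvec = matvec_price (dx + dy), vecop = vecop_price (dx + dy) \<rparr> schur (saddle_field dx dy f)
                   \<Gamma> tol (x0 @\<^sub>v y0) T (m (dx + dy)) (3 * \<rho> * real (m (dx + dy))))
              \<le> C * ((N + real (dx + dy) ^ 2) * (real (dx + dy) + real (dx + dy) powr (2/3) * \<epsilon> powr (- (2/3))))
                  * ln (real (dx + dy) + 1 / \<epsilon> + 2) ^ 1)"
      unfolding d_def[symmetric]
      by (rule exI[of _ T], rule exI[of _ \<Gamma>], rule exI[of _ tol], intro conjI[OF \<Gamma>] conjI[OF tol] allI impI)
        (rule key[OF _ refl])
  qed
qed

end
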